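(* Let $p$ be a power of $2$, $q$ a power of $p$, $q_1$ a power of $p$ with $q_1^2\mid q$, and write $q=q_1^{2n}$. Let $\mathbb{F}$ be an algebraic closure, $e\ge1$, and $F(x)=\sum_{i=0}^eb_ix^{p^i}\in\mathbb{F}_q[x]$ with: (i) $b_0b_e\ne0$; (ii) $F^\ast(1)=0$; (iii) $W_F^\ast:=\{x\in\mathbb{F}\mid F^\ast(x)=0\}\subset\mathbb{F}_q$; (iv) $\{x\in\mathbb{F}\mid F^\ast(F(x))=0\}\subset\mathbb{F}_q$; assume further $W_F^\ast\subset\mathbb{F}_{q_1}$. Put $R:=R_F$, $E_F(x):=F^\ast(F(x))$. Then: (1) there exists $t_0\in\mathbb{F}_{q_1^2}$ with $t_0^{q_1}+t_0=1$; (2) for any such $t_0$, $S_F=\{t_0+F(u)\mid u\in\mathbb{F}_q\}$ and $T_{R,\max}\cup T_{R,\min}=\{\alpha_F(t_0)+E_F(u)^2\mid u\in\mathbb{F}_q\}$; (3) for any such $t_0$, $S_{F,-}=\{t_0+F(u)\mid u\in\mathbb{F}_q,\ \mathrm{Tr}_{\mathbb{F}_q/\mathbb{F}_2}(uR_{F,t_0}(u))\equiv n+1\pmod 2\}$ and $T_{R,\max}=\{\alpha_F(t_0)+E_F(u)^2\mid u\in\mathbb{F}_q,\ \mathrm{Tr}_{\mathbb{F}_q/\mathbb{F}_2}(uR_{F,t_0}(u))\equiv n+1\pmod 2\}$.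
   Context: $F^\ast(x):=\sum_{i=0}^e(b_ix)^{p^{-i}}$. $R_F(x):=\sum_{i=1}^ea_ix^{p^i}$, $a_i=\sum_{j=0}^{e-i}(b_jb_{j+i})^{p^{-j}}$; $\gamma_F:=\sum_{0\le i<j\le e}b_i^{p^{-i}}b_j^{p^{-j}}$; $\alpha_F(t)=\gamma_F+F^\ast(t)^2$; $R_{F,t}(x)=R_F(x)+\alpha_F(t)x$. For $a\in\mathbb{F}_q$, $C_a$ is the curve $y^p-y=x(R(x)+ax)$; $T_{R,\max}:=\{a:|C_a(\mathbb{F}_q)|=q+(p-1)p^e\sqrt q\}$, $T_{R,\min}:=\{a:|C_a(\mathbb{F}_q)|=q-(p-1)p^e\sqrt q\}$. With $\ell$ odd, a fixed primitive 4th root of unity $\sqrt{-1}\in\overline{\mathbb{Q}}_\ell$, the character $\xi_2$ of $W_2(\mathbb{F}_2)\cong\mathbb{Z}/4$ (Witt vectors of length 2, $(a,b)+(c,d)=(a+c,b+d+ac)$) with $\xi_2(1,0)=\sqrt{-1}$, and $q=2^N$: $Q_q(x):=\xi_2(\sum_{i=0}^{N-1}(x^{2^i},0))$, $\psi_q(x):=(-1)^{\mathrm{Tr}_{\mathbb{F}_q/\mathbb{F}_2}(x)}$. $S_F:=\{t\in\mathbb{F}_q\mid Q_q(v)=\psi_q(tv)\ \forall v\in W_F^\ast\}$, $S_{F,-}:=\{t\in S_F\mid Q_q(t)=-(\sqrt{-1})^{[\mathbb{F}_q:\mathbb{F}_2]/2}\}$. *)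

theory Defs
  imports "HOL-Computational_Algebra.Computational_Algebra"
begin

section \<open>Fields\<close>

text \<open>Together with the sort \<open>alg_closed_field\<close>, \<open>algebraic_extension K\<close> says that the whole type is
  an algebraic closure of its subfield \<open>K\<close>.\<close>

definition algebraic_extension :: "'a::field set \<Rightarrow> bool" where
  "algebraic_extension K \<longleftrightarrow>
     (\<forall>x. \<exists>P. P \<noteq> 0 \<and> (\<forall>i. coeff P i \<in> K) \<and> poly P x = 0)"

text \<open>For \<open>q\<close> a power of the characteristic of an algebraically closed field, this is its unique
  subfield with \<open>q\<close> elements.\<close>

definition GF :: "nat \<Rightarrow> 'a::field set" where
  "GF q = {x. x ^ q = x}"

text \<open>\<open>proot k x\<close> is \<open>x\<^bsup>1/k\<^esup>\<close>. It is used only for \<open>k\<close> a power of the characteristic of an algebraically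
  closed field, where \<open>y \<mapsto> y\<^bsup>k\<^esup>\<close> is a bijection.\<close>

definition proot :: "nat \<Rightarrow> 'a::field \<Rightarrow> 'a" where
  "proot k x = (THE y. y ^ k = x)"

text \<open>The library has no \<open>\<ell>\<close>-adic numbers. The field of \<open>\<ell>\<close>-adic numbers is described here as the
  completion of the rationals for the \<open>\<ell>\<close>-adic absolute value: a field with a complete ultrametric
  absolute value \<open>v\<close>, normalized by \<open>v \<ell> = 1 / \<ell>\<close>, in which the rationals are dense.\<close>

definition is_padic_field :: "nat \<Rightarrow> 'c::field_char_0 set \<Rightarrow> bool" where
  "is_padic_field l K \<longleftrightarrow>
     1 \<in> K \<and> (\<forall>x\<in>K. \<forall>y\<in>K. x - y \<in> K \<and> x * y \<in> K) \<and> (\<forall>x\<in>K. inverse x \<in> K) \<and>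
     (\<exists>v :: 'c \<Rightarrow> real.
        v 0 = 0 \<and> (\<forall>x\<in>K. x \<noteq> 0 \<longrightarrow> v x > 0) \<and>
        (\<forall>x\<in>K. \<forall>y\<in>K. v (x * y) = v x * v y \<and> v (x + y) \<le> max (v x) (v y)) \<and>
        v (of_nat l) = 1 / real l \<and>
        (\<forall>x\<in>K. \<forall>\<epsilon>>0. \<exists>r\<in>\<rat>. v (x - r) < \<epsilon>) \<and>
        (\<forall>s :: nat \<Rightarrow> 'c. (\<forall>k. s k \<in> K) \<and> (\<forall>\<epsilon>>0. \<exists>M. \<forall>i\<ge>M. \<forall>j\<ge>M. v (s i - s j) < \<epsilon>) \<longrightarrow>
           (\<exists>y\<in>K. \<forall>\<epsilon>>0. \<exists>M. \<forall>i\<ge>M. v (s i - y) < \<epsilon>)))"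

definition is_padic_alg_closure :: "nat \<Rightarrow> 'c::{field_char_0,alg_closed_field} itself \<Rightarrow> bool" where
  "is_padic_alg_closure l _ \<longleftrightarrow> (\<exists>K :: 'c set. is_padic_field l K \<and> algebraic_extension K)"

section \<open>The polynomial \<open>F\<close> and the expressions attached to it\<close>

text \<open>Throughout, \<open>p\<close>, \<open>e\<close> and \<open>b\<close> give the additive polynomial with coefficients
  \<open>b 0, \<dots>, b e\<close>; the values of \<open>b\<close> beyond \<open>e\<close> are never used.\<close>

definition F :: "nat \<Rightarrow> nat \<Rightarrow> (nat \<Rightarrow> 'a::field) \<Rightarrow> 'a \<Rightarrow> 'a" where
  "F p e b x = (\<Sum>i\<le>e. b i * x ^ (p ^ i))"

definition F_star :: "nat \<Rightarrow> nat \<Rightarrow> (nat \<Rightarrow> 'a::field) \<Rightarrow> 'a \<Rightarrow> 'a" where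
  "F_star p e b x = (\<Sum>i\<le>e. proot (p ^ i) (b i * x))"

definition E_F :: "nat \<Rightarrow> nat \<Rightarrow> (nat \<Rightarrow> 'a::field) \<Rightarrow> 'a \<Rightarrow> 'a" where
  "E_F p e b x = F_star p e b (F p e b x)"

definition W_star :: "nat \<Rightarrow> nat \<Rightarrow> (nat \<Rightarrow> 'a::field) \<Rightarrow> 'a set" where
  "W_star p e b = {x. F_star p e b x = 0}"

definition R_coeff :: "nat \<Rightarrow> nat \<Rightarrow> (nat \<Rightarrow> 'a::field) \<Rightarrow> nat \<Rightarrow> 'a" where
  "R_coeff p e b i = (\<Sum>j=0..e-i. proot (p ^ j) (b j * b (j + i)))"

definition R_F :: "nat \<Rightarrow> nat \<Rightarrow> (nat \<Rightarrow> 'a::field) \<Rightarrow> 'a \<Rightarrow> 'a" where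
  "R_F p e b x = (\<Sum>i=1..e. R_coeff p e b i * x ^ (p ^ i))"

definition gamma_F :: "nat \<Rightarrow> nat \<Rightarrow> (nat \<Rightarrow> 'a::field) \<Rightarrow> 'a" where
  "gamma_F p e b = (\<Sum>j\<le>e. \<Sum>i<j. proot (p ^ i) (b i) * proot (p ^ j) (b j))"

definition alpha_F :: "nat \<Rightarrow> nat \<Rightarrow> (nat \<Rightarrow> 'a::field) \<Rightarrow> 'a \<Rightarrow> 'a" where
  "alpha_F p e b t = gamma_F p e b + (F_star p e b t)\<^sup>2"

definition R_Ft :: "nat \<Rightarrow> nat \<Rightarrow> (nat \<Rightarrow> 'a::field) \<Rightarrow> 'a \<Rightarrow> 'a \<Rightarrow> 'a" where
  "R_Ft p e b t x = R_F p e b x + alpha_F p e b t * x"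

section \<open>Point counts\<close>

text \<open>The points of the affine curve: with the point at infinity the Hasse-Weil bound is
  \<open>q + 1 \<plusminus> (p - 1) p\<^bsup>e\<^esup> \<surd>q\<close>, so that the counts in \<open>T_max\<close> and \<open>T_min\<close> are affine ones.\<close>

definition C_points :: "nat \<Rightarrow> nat \<Rightarrow> ('a::field \<Rightarrow> 'a) \<Rightarrow> 'a \<Rightarrow> ('a \<times> 'a) set" where
  "C_points p q R a = {(x, y). x \<in> GF q \<and> y \<in> GF q \<and> y ^ p - y = x * (R x + a * x)}"

definition T_max :: "nat \<Rightarrow> nat \<Rightarrow> nat \<Rightarrow> ('a::field \<Rightarrow> 'a) \<Rightarrow> 'a set" where
  "T_max p q e R = {a \<in> GF q.
     real (card (C_points p q R a)) = real q + (real p - 1) * real p ^ e * sqrt (real q)}"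

definition T_min :: "nat \<Rightarrow> nat \<Rightarrow> nat \<Rightarrow> ('a::field \<Rightarrow> 'a) \<Rightarrow> 'a set" where
  "T_min p q e R = {a \<in> GF q.
     real (card (C_points p q R a)) = real q - (real p - 1) * real p ^ e * sqrt (real q)}"

section \<open>Witt vectors of length 2 and the quadratic character\<close>

datatype 'a witt2 = Witt 'a 'a

text \<open>This addition is the Witt vector addition for the prime 2 over rings of characteristic 2. It
  defines an abelian group over every commutative ring.\<close>

instantiation witt2 :: (comm_ring) ab_group_add
begin

definition zero_witt2 :: "'a witt2" where
  "zero_witt2 = Witt 0 0"

fun plus_witt2 :: "'a witt2 \<Rightarrow> 'a witt2 \<Rightarrow> 'a witt2" where
  "plus_witt2 (Witt a b) (Witt c d) = Witt (a + c) (b + d + a * c)"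

fun uminus_witt2 :: "'a witt2 \<Rightarrow> 'a witt2" where
  "uminus_witt2 (Witt a b) = Witt (- a) (a * a - b)"

definition minus_witt2 :: "'a witt2 \<Rightarrow> 'a witt2 \<Rightarrow> 'a witt2" where
  "minus_witt2 v w = v + - w"

instance
proof
  fix u v w :: "'a witt2"
  show "u + v + w = u + (v + w)"
    by (cases u; cases v; cases w) (simp add: algebra_simps)
  show "u + v = v + u"
    by (cases u; cases v) (simp add: algebra_simps)
  show "0 + u = u"
    by (cases u) (simp add: zero_witt2_def)
  show "- u + u = 0"
    by (cases u) (simp add: zero_witt2_def)
  show "u - v = u + - v"
    by (simp add: minus_witt2_def)
qed

end

definition W2 :: "'a set \<Rightarrow> 'a witt2 set" where
  "W2 K = {Witt a b | a b. a \<in> K \<and> b \<in> K}"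

definition is_character_on :: "'g::ab_group_add set \<Rightarrow> ('g \<Rightarrow> 'c::field) \<Rightarrow> bool" where
  "is_character_on G \<chi> \<longleftrightarrow>
     (\<forall>v\<in>G. \<chi> v \<noteq> 0) \<and> (\<forall>v\<in>G. \<forall>w\<in>G. \<chi> (v + w) = \<chi> v * \<chi> w)"

text \<open>The trace from the field with \<open>2\<^bsup>N\<^esup>\<close> elements to the field with 2 elements, whose elements are
  the \<open>0\<close> and \<open>1\<close> of the ambient field.\<close>

definition Tr2 :: "nat \<Rightarrow> 'a::field \<Rightarrow> 'a" where
  "Tr2 N x = (\<Sum>i<N. x ^ (2 ^ i))"

definition psi :: "nat \<Rightarrow> 'a::field \<Rightarrow> 'c::field" where
  "psi N x = (if Tr2 N x = 0 then 1 else - 1)"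

text \<open>On the field with \<open>2\<^bsup>N\<^esup>\<close> elements the argument of \<open>\<xi>\<close> lies in \<open>W2 (GF 2)\<close>.\<close>

definition Q :: "('a::field witt2 \<Rightarrow> 'c::field) \<Rightarrow> nat \<Rightarrow> 'a \<Rightarrow> 'c" where
  "Q \<xi> N x = \<xi> (\<Sum>i<N. Witt (x ^ (2 ^ i)) 0)"

definition S_F ::
  "('a::field witt2 \<Rightarrow> 'c::field) \<Rightarrow> nat \<Rightarrow> nat \<Rightarrow> nat \<Rightarrow> (nat \<Rightarrow> 'a) \<Rightarrow> 'a set" where
  "S_F \<xi> N p e b = {t \<in> GF (2 ^ N). \<forall>v\<in>W_star p e b. Q \<xi> N v = psi N (t * v)}"

text \<open>Here \<open>N\<close> is the degree of the field with \<open>2\<^bsup>N\<^esup>\<close> elements over its prime field, assumed even, and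
  \<open>\<iota>\<close> is the chosen square root of \<open>-1\<close>.\<close>

definition S_F_minus ::
  "'c::field \<Rightarrow> ('a::field witt2 \<Rightarrow> 'c) \<Rightarrow> nat \<Rightarrow> nat \<Rightarrow> nat \<Rightarrow> (nat \<Rightarrow> 'a) \<Rightarrow> 'a set" where
  "S_F_minus \<iota> \<xi> N p e b = {t \<in> S_F \<xi> N p e b. Q \<xi> N t = - (\<iota> ^ (N div 2))}"

end

theory Submission
  imports Defs
begin

text \<open>
  \<open>Q\<close> is a quadratic character of the field \<open>K\<close> with \<open>q\<close> elements, with polarization \<open>\<psi>(xy)\<close>, and \<open>F\<close>, \<open>F\<^sup>*\<close> are
  adjoint for the trace form. Together with \<open>F\<^sup>*(1) = 0\<close> this gives \<open>\<psi>(x R\<^bsub>F,t\<^esub>(x)) = Q(F(x)) \<psi>(t F(x))\<close>, so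
  that the exponential sum \<open>S(a)\<close> counting the points of \<open>C\<^sub>a\<close> becomes a sum of values of \<open>Q\<close>. An
  Artin-Schreier element \<open>t\<^sub>0\<close> satisfies \<open>Q(v) = \<psi>(t\<^sub>0 v)\<close> on \<open>W\<^sub>F\<^sup>*\<close> and \<open>Q(t\<^sub>0) = (-1)\<^sup>n \<iota>\<^bsup>N/2\<^esup>\<close>. Fourier inversion
  identifies \<open>F(K)\<close> with the orthogonal complement of \<open>W\<^sub>F\<^sup>*\<close>, evaluates
  \<open>Q(t\<^sub>0) S(\<alpha>\<^sub>F(t\<^sub>0))\<close> as \<open>p\<^sup>e\<close> times the Gauss sum \<open>- \<iota>\<^bsup>N/2\<^esup> \<surd>q\<close>, and shows that \<open>S(a)\<close> vanishes unless
  \<open>a = \<alpha>\<^sub>F(t\<^sub>0) + E\<^sub>F(u)\<^sup>2\<close>, in which case it equals \<open>\<psi>(u R\<^bsub>F,t\<^sub>0\<^esub>(u)) S(\<alpha>\<^sub>F(t\<^sub>0))\<close>.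
\<close>

section \<open>Separable polynomials\<close>

lemma size_proots_alg_closed:
  fixes P :: "'a::alg_closed_field poly"
  assumes "P \<noteq> 0"
  shows "size (proots P) = degree P"
proof -
  obtain A where A: "size A = degree P" "P = smult (lead_coeff P) (\<Prod>x\<in>#A. [:- x, 1:])"
    using alg_closed_imp_factorization[OF assms] by blast
  have "proots (\<Prod>x\<in>#A. [:- x, 1:]) = A"
  proof (induction A)
    case (add x A)
    moreover have "(\<Prod>x\<in>#A. [:- x, 1:]) \<noteq> 0"
      by (auto simp: prod_mset_zero_iff)
    ultimately show ?case
      by (simp add: proots_mult del: mult_pCons_left)
  qed simp
  then have "proots P = A"
    using A(2) assms by (metis leading_coeff_0_iff proots_smult)
  with A(1) show ?thesis by simp
qed

text \<open>A multiple root would also be a root of the derivative, which is a nonzero constant;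
  hence all the roots supplied by algebraic closedness are distinct.\<close>

lemma card_roots_separable:
  fixes P :: "'a::alg_closed_field poly"
  assumes "c \<noteq> 0" and "pderiv P = [:c:]"
  shows "card {x. poly P x = 0} = degree P"
proof -
  have P: "P \<noteq> 0" using assms by auto
  have "order x P \<le> 1" for x
  proof (rule ccontr)
    assume "\<not> order x P \<le> 1"
    then have "[:- x, 1:] ^ 2 dvd P"
      using P by (subst order_divides) auto
    then obtain Q where "P = [:- x, 1:] * ([:- x, 1:] * Q)"
      by (metis dvdE mult.assoc power2_eq_square)
    then have "poly (pderiv P) x = 0"
      by (simp add: pderiv_mult del: mult_pCons_left)
    with assms show False by simp
  qed
  then have "proots P = mset_set {x. poly P x = 0}"
    using P poly_roots_finite[OF P] order_root[of P]
    by (intro multiset_eqI) (auto simp: count_mset_set' le_Suc_eq, metis less_numeral_extra(3))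
  then show ?thesis
    using size_proots_alg_closed[OF P] by simp
qed

section \<open>Frobenius maps and finite subfields in characteristic 2\<close>

locale alg_closed_char_2 =
  fixes ty :: "'k::alg_closed_field itself"
  assumes char_2: "CHAR('k) = 2"
begin

lemma two_eq_0 [simp]: "(2 :: 'k) = 0"
  using of_nat_CHAR[where ?'a = 'k] char_2 by simp

lemma add_self [simp]: "x + x = (0 :: 'k)"
  using mult_2[of x] by simp

lemma add_self_left [simp]: "x + (x + y) = (y :: 'k)"
  by (simp flip: add.assoc)

lemma minus_eq [simp]: "- x = (x :: 'k)"
  using add_self[of x] by (simp only: add_eq_0_iff)

lemma diff_eq_add [simp]: "x - y = x + (y :: 'k)"
  using minus_eq[of y] by (simp only: diff_conv_add_uminus)

lemma add_eq_0_iff_eq: "x + y = 0 \<longleftrightarrow> x = (y :: 'k)"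
  by (metis diff_eq_add eq_iff_diff_eq_0)

lemma frob_add: "(x + y :: 'k) ^ (2 ^ i) = x ^ (2 ^ i) + y ^ (2 ^ i)"
  using freshmans_dream'[where ?'a = 'k] char_2 by simp

lemma frob_sum: "(sum f A :: 'k) ^ (2 ^ i) = (\<Sum>a\<in>A. f a ^ (2 ^ i))"
  using freshmans_dream_sum'[where ?'a = 'k, of "2 ^ i" i f A] char_2 by simp

lemma sq_add: "(x + y :: 'k)\<^sup>2 = x\<^sup>2 + y\<^sup>2"
  using frob_add[of x y 1] by simp

lemma frob_inj: "x ^ (2 ^ i) = y ^ (2 ^ i) \<longleftrightarrow> x = (y :: 'k)"
proof
  assume "x ^ (2 ^ i) = y ^ (2 ^ i)"
  then have "(x + y) ^ (2 ^ i) = 0" by (simp add: frob_add)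
  then show "x = y" by (simp add: add_eq_0_iff_eq)
qed simp

text \<open>Injectivity of Frobenius makes the definite description in \<open>proot\<close> refer to
  any root at hand.\<close>

lemma proot_eqI: "y ^ (2 ^ i) = x \<Longrightarrow> proot (2 ^ i) x = (y :: 'k)"
  unfolding proot_def by (rule the_equality) (auto simp: frob_inj)

lemma proot_power [simp]: "proot (2 ^ i) x ^ (2 ^ i) = (x :: 'k)"
  using nth_root_exists[of "2 ^ i" x] proot_eqI by force

lemma proot_add: "proot (2 ^ i) (x + y) = proot (2 ^ i) x + proot (2 ^ i) (y :: 'k)"
  by (rule proot_eqI) (simp add: frob_add)

lemma proot_0 [simp]: "proot (2 ^ i) (0 :: 'k) = 0"
  by (rule proot_eqI) simp

lemma GF_0 [simp]: "0 \<in> (GF (2 ^ N) :: 'k set)"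
  and GF_1 [simp]: "1 \<in> (GF (2 ^ N) :: 'k set)"
  by (auto simp: GF_def)

lemma GF_add [simp]: "x \<in> GF (2 ^ N) \<Longrightarrow> y \<in> GF (2 ^ N) \<Longrightarrow> x + y \<in> (GF (2 ^ N) :: 'k set)"
  by (auto simp: GF_def frob_add)

lemma GF_mult [simp]: "x \<in> GF m \<Longrightarrow> y \<in> GF m \<Longrightarrow> x * y \<in> (GF m :: 'k set)"
  by (auto simp: GF_def power_mult_distrib)

lemma GF_inverse [simp]: "x \<in> GF m \<Longrightarrow> inverse x \<in> (GF m :: 'k set)"
  by (auto simp: GF_def power_inverse)

lemma GF_power [simp]: "x \<in> GF m \<Longrightarrow> x ^ k \<in> (GF m :: 'k set)"
  by (auto simp: GF_def) (metis mult.commute power_mult)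

lemma GF_sum [simp]:
  "(\<And>i. i \<in> A \<Longrightarrow> f i \<in> GF (2 ^ N)) \<Longrightarrow> sum f A \<in> (GF (2 ^ N) :: 'k set)"
  by (induction A rule: infinite_finite_induct) auto

text \<open>If \<open>y\<close> is the root of \<open>x\<close>, then so is \<open>y ^ m\<close>,
  because \<open>x ^ m = x\<close>; uniqueness of roots gives \<open>y ^ m = y\<close>.\<close>

lemma GF_proot [simp]: "x \<in> GF m \<Longrightarrow> proot (2 ^ i) x \<in> (GF m :: 'k set)"
  by (simp add: GF_def) (metis mult.commute power_mult proot_eqI proot_power)

lemma GF_subset: "GF m \<subseteq> (GF (m ^ k) :: 'k set)"
proof
  fix x :: 'k assume x: "x \<in> GF m"
  show "x \<in> GF (m ^ k)"
  proof (induction k)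
    case (Suc k)
    then show ?case using x by (simp add: GF_def power_mult)
  qed (simp add: GF_def)
qed

lemma GF_2_cases: "x \<in> GF 2 \<Longrightarrow> x = 0 \<or> x = (1 :: 'k)"
  by (auto simp: GF_def power2_eq_square)

text \<open>The elements are the roots of X^(2^N) - X, whose derivative is the constant 1 in
  characteristic 2.\<close>

lemma card_GF:
  assumes "N > 0"
  shows "card (GF (2 ^ N) :: 'k set) = 2 ^ N"
proof -
  define P :: "'k poly" where "P = monom 1 (2 ^ N) - [:0, 1:]"
  have d: "degree P = 2 ^ N"
    unfolding P_def diff_conv_add_uminus using assms
    by (subst degree_add_eq_left) (use one_less_power[of "2 :: nat" N] in \<open>auto simp: degree_monom_eq\<close>)
  have "pderiv P = [:1:]"
    using assms by (simp add: P_def pderiv_diff pderiv_monom pderiv_pCons one_pCons numeral_poly zero_power)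
  from card_roots_separable[OF _ this] d show ?thesis
    by (simp add: P_def GF_def poly_monom add_eq_0_iff_eq)
qed

lemma finite_GF: "N > 0 \<Longrightarrow> finite (GF (2 ^ N) :: 'k set)"
  using card_GF[of N] by (metis card.infinite power_not_zero zero_neq_numeral)

end

section \<open>Additive characters\<close>

text \<open>Translation by \<open>a\<close> permutes \<open>G\<close>, so the sum equals
  \<open>c\<close> times itself. This is the source of all vanishing of character sums
  below.\<close>

lemma sum_shift_eq_0:
  fixes f :: "'a::ab_group_add \<Rightarrow> 'c::field"
  assumes "finite G" and "\<And>y. y \<in> G \<Longrightarrow> y + a \<in> G" and "\<And>y. y \<in> G \<Longrightarrow> f (y + a) = c * f y"
    and "c \<noteq> 1"
  shows "sum f G = 0"
proof -
  have "(\<lambda>y. y + a) ` G = G"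
    using assms(1,2) by (intro endo_inj_surj) (auto intro: inj_onI)
  then have "sum f G = (\<Sum>y\<in>G. f (y + a))"
    using sum.reindex[of "\<lambda>y. y + a" G f] by (simp add: inj_on_def)
  also have "\<dots> = c * sum f G"
    by (simp add: assms(3) sum_distrib_left)
  finally show ?thesis using assms(4) by (metis mult_cancel_right1)
qed

context alg_closed_char_2
begin

lemma Tr2_add: "Tr2 N (x + y :: 'k) = Tr2 N x + Tr2 N y"
  by (simp add: Tr2_def frob_add sum.distrib)

lemma Tr2_0 [simp]: "Tr2 N (0 :: 'k) = 0"
  by (simp add: Tr2_def zero_power)

lemma Tr2_sum: "Tr2 N (sum f A :: 'k) = (\<Sum>a\<in>A. Tr2 N (f a))"
  by (induction A rule: infinite_finite_induct) (auto simp: Tr2_add)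

text \<open>Squaring permutes the conjugates cyclically; after adding \<open>x\<close>, both sides
  are the sum of the first \<open>Suc N\<close> Frobenius iterates.\<close>

lemma Tr2_sq: "x \<in> GF (2 ^ N) \<Longrightarrow> Tr2 N (x\<^sup>2 :: 'k) = Tr2 N x"
proof -
  assume x: "x \<in> GF (2 ^ N)"
  have "Tr2 N (x\<^sup>2) + x = (\<Sum>i<Suc N. x ^ (2 ^ i))"
    by (subst sum.lessThan_Suc_shift) (simp add: Tr2_def add.commute flip: power_mult)
  also have "\<dots> = Tr2 N x + x"
    using x by (simp add: Tr2_def GF_def)
  finally show ?thesis by simp
qed

lemma Tr2_frob: "x \<in> GF (2 ^ N) \<Longrightarrow> Tr2 N (x ^ (2 ^ j) :: 'k) = Tr2 N x"
proof (induction j)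
  case (Suc j)
  then have "Tr2 N ((x ^ (2 ^ j))\<^sup>2) = Tr2 N x"
    by (subst Tr2_sq) auto
  then show ?case by (simp add: mult.commute flip: power_mult)
qed simp

lemma Tr2_proot: "x \<in> GF (2 ^ N) \<Longrightarrow> Tr2 N (proot (2 ^ j) x :: 'k) = Tr2 N x"
  using Tr2_frob[of "proot (2 ^ j) x" N j] by simp

lemma Tr2_cases: "x \<in> GF (2 ^ N) \<Longrightarrow> Tr2 N x = 0 \<or> Tr2 N x = (1 :: 'k)"
  using Tr2_sq[of x N]
  by (intro GF_2_cases)
    (simp add: GF_def Tr2_def frob_sum[where i = 1, simplified] flip: power_mult, simp add: mult.commute)

text \<open>The trace is a polynomial of degree at most 2^(N-1) with linear coefficient 1, so it
  cannot vanish on all 2^N elements.\<close>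

lemma Tr2_nonzero:
  assumes "N > 0"
  shows "\<exists>x\<in>GF (2 ^ N). Tr2 N x \<noteq> (0 :: 'k)"
proof (rule ccontr)
  assume "\<not> ?thesis"
  then have sub: "GF (2 ^ N) \<subseteq> {x :: 'k. Tr2 N x = 0}" by auto
  define P :: "'k poly" where "P = (\<Sum>i<N. monom 1 (2 ^ i))"
  have "coeff P 1 = (\<Sum>i<N. if i = 0 then 1 else 0)"
    unfolding P_def coeff_sum by (intro sum.cong) auto
  then have "P \<noteq> 0" using assms by auto
  have "degree P \<le> 2 ^ (N - 1)"
    unfolding P_def by (rule degree_sum_le) (auto intro!: order.trans[OF degree_monom_le] power_increasing)
  moreover have "{x. poly P x = 0} = {x. Tr2 N x = 0}"
    by (simp add: P_def Tr2_def poly_sum poly_monom)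
  ultimately have "card {x :: 'k. Tr2 N x = 0} \<le> 2 ^ (N - 1)" "finite {x :: 'k. Tr2 N x = 0}"
    using card_poly_roots_bound[OF \<open>P \<noteq> 0\<close>] poly_roots_finite[OF \<open>P \<noteq> 0\<close>] by auto
  then have "(2 :: nat) ^ N \<le> 2 ^ (N - 1)"
    using card_mono[OF \<open>finite {x :: 'k. Tr2 N x = 0}\<close> sub] card_GF[OF assms] by linarith
  with assms show False by simp
qed

lemma psi_0 [simp]: "psi N (0 :: 'k) = 1"
  by (simp add: psi_def)

lemma psi_mult_self [simp]: "psi N (x :: 'k) * psi N x = 1"
  by (simp add: psi_def)

lemma psi_add:
  "x \<in> GF (2 ^ N) \<Longrightarrow> y \<in> GF (2 ^ N) \<Longrightarrow> psi N (x + y :: 'k) = psi N x * psi N y"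
  using Tr2_cases[of x N] Tr2_cases[of y N] by (auto simp: psi_def Tr2_add)

lemma psi_cong: "Tr2 N x = Tr2 N y \<Longrightarrow> psi N (x :: 'k) = psi N (y :: 'k)"
  by (simp add: psi_def)

lemma sum_psi:
  assumes "N > 0" and "w \<in> GF (2 ^ N)"
  shows "(\<Sum>y\<in>GF (2 ^ N). psi N (y * w :: 'k)) = (if w = 0 then 2 ^ N else (0 :: 'c::field_char_0))"
proof (cases "w = 0")
  case False
  obtain x where x: "x \<in> GF (2 ^ N)" "Tr2 N x \<noteq> (0 :: 'k)"
    using Tr2_nonzero assms(1) by blast
  \<comment> \<open>Shifting \<open>y\<close> by this amount changes \<open>y * w\<close> by
    \<open>x\<close>, an element where \<open>psi\<close> is -1.\<close>
  let ?a = "x * inverse w"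
  have "?a * w = x" using False by simp
  then have "(\<Sum>y\<in>GF (2 ^ N). psi N (y * w :: 'k)) = (0 :: 'c)"
    using x assms
    by (intro sum_shift_eq_0[where a = ?a and c = "- 1"])
      (auto simp: finite_GF distrib_right psi_add \<open>?a * w = x\<close>, simp add: psi_def \<open>?a * w = x\<close>)
  then show ?thesis using False by simp
qed (use assms in \<open>simp add: card_GF\<close>)

text \<open>Fourier inversion, with \<open>B\<close> the adjoint of \<open>A\<close> for the trace form.\<close>

lemma card_fibre:
  assumes N: "N > 0" and A: "\<And>u. u \<in> GF (2 ^ N) \<Longrightarrow> A u \<in> GF (2 ^ N)"
    and B: "\<And>y. y \<in> GF (2 ^ N) \<Longrightarrow> B y \<in> GF (2 ^ N)"
    and adj: "\<And>u y. u \<in> GF (2 ^ N) \<Longrightarrow> y \<in> GF (2 ^ N) \<Longrightarrow> Tr2 N (y * A u) = Tr2 N (u * B y)"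
    and z: "z \<in> GF (2 ^ N)"
  shows "of_nat (card {u \<in> GF (2 ^ N). A u = (z :: 'k)})
    = (\<Sum>y | y \<in> GF (2 ^ N) \<and> B y = 0. psi N (y * z) :: 'c::field_char_0)"
proof -
  let ?K = "GF (2 ^ N) :: 'k set"
  note fin = finite_GF[OF N]
  have "2 ^ N * of_nat (card {u \<in> ?K. A u = z}) = (\<Sum>u\<in>?K. if A u + z = 0 then 2 ^ N else (0 :: 'c))"
    using fin by (simp add: sum.If_cases add_eq_0_iff_eq Int_def mult.commute)
  also have "\<dots> = (\<Sum>u\<in>?K. \<Sum>y\<in>?K. psi N (y * (A u + z)))"
    by (intro sum.cong refl sum_psi[symmetric] N GF_add A z)
  also have "\<dots> = (\<Sum>y\<in>?K. \<Sum>u\<in>?K. psi N (y * z) * psi N (u * B y))"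
    using adj A z
    by (subst sum.swap, intro sum.cong refl)
      (auto simp: distrib_left psi_add mult.commute[of "psi N (_ * z)"] intro: psi_cong)
  also have "\<dots> = (\<Sum>y\<in>?K. psi N (y * z) * (if B y = 0 then 2 ^ N else 0))"
    using B N by (intro sum.cong) (auto simp: sum_psi simp flip: sum_distrib_left)
  also have "\<dots> = 2 ^ N * (\<Sum>y | y \<in> ?K \<and> B y = 0. psi N (y * z))"
    using fin by (simp add: sum_distrib_left mult.commute if_distrib Int_def sum.If_cases cong: if_cong)
  finally show ?thesis by simp
qed

text \<open>The range of \<open>A\<close> is the orthogonal complement of the kernel of its adjoint.
  For the harder direction, \<open>card_fibre\<close> gives the fibre over \<open>z\<close> as many
  elements as the kernel of \<open>B\<close>, which contains 0.\<close>

lemma range_iff_psi_kernel: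
  assumes N: "N > 0" and A: "\<And>u. u \<in> GF (2 ^ N) \<Longrightarrow> A u \<in> GF (2 ^ N)"
    and B: "\<And>y. y \<in> GF (2 ^ N) \<Longrightarrow> B y \<in> GF (2 ^ N)"
    and adj: "\<And>u y. u \<in> GF (2 ^ N) \<Longrightarrow> y \<in> GF (2 ^ N) \<Longrightarrow> Tr2 N (y * A u) = Tr2 N (u * B y)"
    and B0: "B 0 = 0"
    and z: "z \<in> GF (2 ^ N)"
  shows "(\<exists>u\<in>GF (2 ^ N). A u = (z :: 'k)) \<longleftrightarrow>
    (\<forall>y\<in>GF (2 ^ N). B y = 0 \<longrightarrow> psi N (y * z) = (1 :: 'c::field_char_0))"
proof
  assume "\<exists>u\<in>GF (2 ^ N). A u = z"
  then show "\<forall>y\<in>GF (2 ^ N). B y = 0 \<longrightarrow> psi N (y * z) = (1 :: 'c)"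
    using adj by (force simp: psi_def)
next
  assume *: "\<forall>y\<in>GF (2 ^ N). B y = 0 \<longrightarrow> psi N (y * z) = (1 :: 'c)"
  let ?W = "{y \<in> GF (2 ^ N). B y = 0}"
  have "of_nat (card {u \<in> GF (2 ^ N). A u = z}) = (of_nat (card ?W) :: 'c)"
    using card_fibre[of N A B z, where ?'c = 'c] N A B adj z * by simp
  then have "card {u \<in> GF (2 ^ N). A u = z} = card ?W"
    by (simp only: of_nat_eq_iff)
  moreover have "card ?W > 0"
    using B0 finite_GF[OF N] by (subst card_gt_0_iff) (auto intro!: exI[of _ 0])
  ultimately show "\<exists>u\<in>GF (2 ^ N). A u = z"
    by (metis (mono_tags, lifting) card.empty empty_Collect_eq less_irrefl)
qed

end

section \<open>The quadratic character\<close>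

lemma sum_lessThan_add:
  fixes f :: "nat \<Rightarrow> 'a::comm_monoid_add"
  shows "(\<Sum>i<m + n. f i) = (\<Sum>i<m. f i) + (\<Sum>i<n. f (m + i))"
  by (induction n) (auto simp: add_ac)

lemma sum_Witt_0: "(\<Sum>i\<in>A. Witt 0 (f i)) = Witt 0 (sum f A :: 'a::comm_ring)"
  by (induction A rule: infinite_finite_induct) (auto simp: zero_witt2_def)

lemma Witt_add_split: "Witt a 0 + Witt c 0 = Witt (a + c) 0 + Witt 0 (a * c :: 'a::comm_ring)"
  by simp

text \<open>The carries of Witt addition are collected in the second component. For conjugates of
  \<open>x\<close> and \<open>y\<close> their sum is the trace of \<open>x * y\<close>, the origin
  of the polarization of \<open>Q\<close>.\<close>

lemma sum_Witt_add:
  "(\<Sum>i\<in>A. Witt (f i) 0) + (\<Sum>i\<in>A. Witt (g i) 0)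
    = (\<Sum>i\<in>A. Witt (f i + g i) 0) + Witt 0 (\<Sum>i\<in>A. f i * g i :: 'a::comm_ring)"
proof -
  have "(\<Sum>i\<in>A. Witt (f i) 0 + Witt (g i) 0) = (\<Sum>i\<in>A. Witt (f i + g i) 0 + Witt 0 (f i * g i))"
    by (simp only: Witt_add_split)
  then show ?thesis by (simp only: sum.distrib sum_Witt_0)
qed

locale witt_character = alg_closed_char_2 ty
  for ty :: "'k::alg_closed_field itself" +
  fixes \<xi> :: "'k witt2 \<Rightarrow> 'c::field_char_0" and \<iota> :: 'c
  assumes iota: "\<iota>\<^sup>2 = - 1"
    and xi: "is_character_on (W2 (GF 2)) \<xi>" "\<xi> (Witt 1 0) = \<iota>"
begin

lemma xi_add: "v \<in> W2 (GF 2) \<Longrightarrow> w \<in> W2 (GF 2) \<Longrightarrow> \<xi> (v + w) = \<xi> v * \<xi> w"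
  and xi_nonzero: "v \<in> W2 (GF 2) \<Longrightarrow> \<xi> v \<noteq> 0"
  using xi(1) by (auto simp: is_character_on_def)

text \<open>Being fixed by the additive Frobenius on Witt vectors is a condition that passes to
  sums.\<close>

lemma W2_GF_2_iff: "v \<in> W2 (GF 2) \<longleftrightarrow> map_witt2 (\<lambda>x. x\<^sup>2) v = (v :: 'k witt2)"
  by (cases v) (auto simp: W2_def GF_def)

lemma W2_Witt [simp]: "Witt a b \<in> W2 K \<longleftrightarrow> a \<in> K \<and> b \<in> K"
  by (auto simp: W2_def)

lemma witt_frob_add:
  "map_witt2 (\<lambda>x. x\<^sup>2) (v + w) = map_witt2 (\<lambda>x. x\<^sup>2) v + map_witt2 (\<lambda>x. x\<^sup>2) (w :: 'k witt2)"
  by (cases v; cases w) (simp add: sq_add power_mult_distrib)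

lemma W2_add [simp]: "v \<in> W2 (GF 2) \<Longrightarrow> w \<in> W2 (GF 2) \<Longrightarrow> v + w \<in> (W2 (GF 2) :: 'k witt2 set)"
  by (simp add: W2_GF_2_iff witt_frob_add)

lemma witt_frob_sum:
  "map_witt2 (\<lambda>x. x\<^sup>2) (sum f A) = (\<Sum>i\<in>A. map_witt2 (\<lambda>x. x\<^sup>2) (f i :: 'k witt2))"
  by (induction A rule: infinite_finite_induct) (auto simp: witt_frob_add zero_witt2_def)

lemma sum_Witt_sq:
  assumes "x \<in> GF (2 ^ N)"
  shows "(\<Sum>i<N. Witt ((x\<^sup>2) ^ (2 ^ i)) 0) = (\<Sum>i<N. Witt (x ^ (2 ^ i) :: 'k) 0)"
proof -
  have "Witt x 0 + (\<Sum>i<N. Witt ((x\<^sup>2) ^ (2 ^ i)) 0) = (\<Sum>i<Suc N. Witt (x ^ (2 ^ i)) 0)"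
    by (subst sum.lessThan_Suc_shift) (simp flip: power_mult)
  also have "\<dots> = Witt x 0 + (\<Sum>i<N. Witt (x ^ (2 ^ i)) 0)"
    using assms by (simp add: GF_def add.commute)
  finally show ?thesis by simp
qed

lemma sum_Witt_in_W2 [simp]:
  assumes "x \<in> GF (2 ^ N)"
  shows "(\<Sum>i<N. Witt (x ^ (2 ^ i) :: 'k) 0) \<in> W2 (GF 2)"
  using sum_Witt_sq[OF assms]
  by (simp add: W2_GF_2_iff witt_frob_sum mult.commute flip: power_mult)

lemma xi_0 [simp]: "\<xi> 0 = 1" "\<xi> (Witt 0 0) = 1"
proof -
  have "(0 :: 'k witt2) \<in> W2 (GF 2)" by (auto simp: zero_witt2_def GF_def)
  then show "\<xi> 0 = 1"
    using xi_add[of 0 0] xi_nonzero[of 0] by auto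
  then show "\<xi> (Witt 0 0) = 1" by (simp add: zero_witt2_def)
qed

text \<open>\<open>Witt 0 1\<close> is twice \<open>Witt 1 0\<close>, so its value is the square of
  \<open>\<iota>\<close>.\<close>

lemma xi_Witt_0_1: "\<xi> (Witt 0 1) = - 1"
  using xi_add[of "Witt 1 0" "Witt 1 0"] xi(2) iota
  by (simp add: GF_def power2_eq_square)

lemma xi_Witt_Tr2: "x \<in> GF (2 ^ N) \<Longrightarrow> \<xi> (Witt 0 (Tr2 N x)) = psi N x"
  using Tr2_cases[of x N] xi_Witt_0_1 by (auto simp: psi_def)

lemma Tr2_in_GF_2: "x \<in> GF (2 ^ N) \<Longrightarrow> Tr2 N x \<in> (GF 2 :: 'k set)"
  using Tr2_cases[of x N] by (auto simp: GF_def)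

lemma Q_nonzero [simp]: "x \<in> GF (2 ^ N) \<Longrightarrow> Q \<xi> N x \<noteq> 0"
  by (simp add: Q_def xi_nonzero)

lemma Q_0 [simp]: "Q \<xi> N 0 = 1"
  by (simp add: Q_def zero_power flip: zero_witt2_def)

text \<open>The carry \<open>Witt 0 (Tr2 N (x * y))\<close> is sent by \<open>\<xi>\<close> to
  \<open>psi N (x * y)\<close>, a sign, which may therefore be moved to the other side.\<close>

lemma Q_add:
  assumes "x \<in> GF (2 ^ N)" and "y \<in> GF (2 ^ N)"
  shows "Q \<xi> N (x + y) = Q \<xi> N x * Q \<xi> N y * psi N (x * y)"
proof -
  let ?A = "\<lambda>x. \<Sum>i<N. Witt (x ^ (2 ^ i) :: 'k) 0"
  have "?A x + ?A y = ?A (x + y) + Witt 0 (Tr2 N (x * y))"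
    by (simp add: sum_Witt_add frob_add Tr2_def power_mult_distrib)
  then have "\<xi> (?A x + ?A y) = \<xi> (?A (x + y) + Witt 0 (Tr2 N (x * y)))" by simp
  also have "\<dots> = Q \<xi> N (x + y) * psi N (x * y)"
    using assms Tr2_in_GF_2[of "x * y" N] GF_0[of 1]
    by (simp add: xi_add xi_Witt_Tr2 Q_def)
  also have "\<xi> (?A x + ?A y) = Q \<xi> N x * Q \<xi> N y"
    using assms by (simp add: xi_add Q_def)
  finally show ?thesis by (simp add: mult.assoc)
qed

lemma Q_sq: "x \<in> GF (2 ^ N) \<Longrightarrow> Q \<xi> N (x\<^sup>2) = Q \<xi> N x"
  by (simp add: Q_def sum_Witt_sq)

lemma Q_frob: "x \<in> GF (2 ^ N) \<Longrightarrow> Q \<xi> N (x ^ (2 ^ j)) = Q \<xi> N x"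
proof (induction j)
  case (Suc j)
  then have "Q \<xi> N ((x ^ (2 ^ j))\<^sup>2) = Q \<xi> N x"
    by (subst Q_sq) auto
  then show ?case by (simp add: mult.commute flip: power_mult)
qed simp

lemma psi_sq: "x \<in> GF (2 ^ N) \<Longrightarrow> psi N (x\<^sup>2 :: 'k) = (psi N x :: 'c)"
  by (simp add: psi_def Tr2_sq)

text \<open>This is \<open>Q_add\<close> with equal arguments, since \<open>x + x = 0\<close> and
  \<open>psi\<close> is invariant under squaring.\<close>

lemma Q_mult_self: "x \<in> GF (2 ^ N) \<Longrightarrow> Q \<xi> N x * Q \<xi> N x = psi N x"
  using Q_add[of x N x] psi_sq[of x N]
  by (simp add: power2_eq_square) (metis mult.assoc mult.right_neutral psi_mult_self)

lemma Q_sum: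
  fixes e :: nat
  assumes "\<And>i. i \<le> e \<Longrightarrow> f i \<in> GF (2 ^ N)"
  shows "Q \<xi> N (\<Sum>i\<le>e. f i) = (\<Prod>i\<le>e. Q \<xi> N (f i)) * psi N (\<Sum>j\<le>e. \<Sum>i<j. f i * f j)"
  using assms
proof (induction e)
  case (Suc e)
  have "(\<Sum>i\<le>e. f i) \<in> GF (2 ^ N)" "(\<Sum>j\<le>e. \<Sum>i<j. f i * f j) \<in> GF (2 ^ N)"
    by (intro GF_sum GF_mult Suc.prems; simp)+
  then show ?case using Suc
    by (simp add: Q_add psi_add lessThan_Suc_atMost mult.assoc mult.left_commute flip: sum_distrib_right)
qed simp

section \<open>Field towers and Artin-Schreier elements\<close>

lemma Q_mult_power:
  assumes "x \<in> GF (2 ^ M)"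
  shows "Q \<xi> (k * M) x = Q \<xi> M x ^ k"
proof (induction k)
  case (Suc k)
  have GF: "x \<in> GF (2 ^ (k * M))"
    using assms GF_subset[of "2 ^ M" k] by (auto simp: mult.commute power_mult)
  \<comment> \<open>The conjugates repeat with period \<open>M\<close>, so a sum over
    \<open>k * M\<close> of them is \<open>k\<close> copies of the sum over
    \<open>M\<close>.\<close>
  then have "x ^ (2 ^ (k * M + i)) = x ^ (2 ^ i)" for i
    by (simp add: power_add power_mult GF_def)
  then have "Q \<xi> (k * M + M) x = Q \<xi> (k * M) x * Q \<xi> M x"
    using assms GF unfolding Q_def sum_lessThan_add by (simp add: xi_add)
  then show ?case using Suc by (simp add: add.commute mult.commute)
qed (simp add: Q_def)

lemma psi_mult_power:
  assumes "x \<in> GF (2 ^ M)"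
  shows "psi (k * M) (x :: 'k) = (psi M x ^ k :: 'c)"
proof -
  have GF: "x \<in> GF (2 ^ (k * M))"
    using assms GF_subset[of "2 ^ M" k] by (auto simp: mult.commute power_mult)
  have "psi (k * M) x = Q \<xi> (k * M) x * Q \<xi> (k * M) x"
    using GF by (simp add: Q_mult_self)
  also have "\<dots> = psi M x ^ k"
    using assms by (simp add: Q_mult_power Q_mult_self flip: power_mult_distrib)
  finally show ?thesis .
qed

lemma Tr2_double: "Tr2 (2 * s) (x :: 'k) = Tr2 s (x + x ^ (2 ^ s))"
  by (simp add: mult_2 Tr2_def sum_lessThan_add frob_add sum.distrib power_add power_mult)

lemma artin_schreier_exists: "s > 0 \<Longrightarrow> \<exists>t :: 'k. t ^ (2 ^ s) + t = 1"
proof -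
  assume s: "s > 0"
  let ?P = "monom 1 (2 ^ s) + [:1, 1:] :: 'k poly"
  have "degree ?P = 2 ^ s"
    using s one_less_power[of "2 :: nat" s] by (subst degree_add_eq_left) (auto simp: degree_monom_eq)
  then obtain t where "poly ?P t = 0"
    using alg_closed_imp_poly_has_root[of ?P] by auto
  then show ?thesis
    by (intro exI[of _ t]) (simp add: poly_monom add_eq_0_iff_eq algebra_simps)
qed

lemma artin_schreier_in_GF:
  assumes "t ^ (2 ^ s) + t = (1 :: 'k)"
  shows "t \<in> GF (2 ^ (2 * s))"
proof -
  have "t ^ (2 ^ s) = t + 1" using assms by (metis add.commute add_self_left)
  then have "t ^ (2 ^ s * 2 ^ s) = t"
    by (simp only: power_mult frob_add) (simp add: add.assoc)
  then show ?thesis by (simp add: GF_def mult_2 power_add)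
qed

text \<open>As \<open>t ^ (2 ^ s) = t + 1\<close>, the second half of the Witt sum for
  \<open>t\<close> is the first half of the one for \<open>t + 1\<close>. Adding the two leaves
  \<open>s\<close> copies of \<open>Witt 1 0\<close>, worth \<open>\<iota> ^ s\<close>, and a total
  carry of 1, worth -1.\<close>

lemma Q_artin_schreier:
  assumes t: "t ^ (2 ^ s) + t = (1 :: 'k)"
  shows "Q \<xi> (2 * s) t = - (\<iota> ^ s)"
proof -
  let ?A = "\<lambda>x. \<Sum>i<s. Witt (x ^ (2 ^ i) :: 'k) 0"
  have ts: "t ^ (2 ^ s) = t + 1" using t by (metis add.commute add_self_left)
  \<comment> \<open>The carries telescope, since subtraction is addition here.\<close>
  have "(\<Sum>i<s. t ^ (2 ^ i) * (t + 1) ^ (2 ^ i)) = (\<Sum>i<s. t ^ (2 ^ Suc i) + t ^ (2 ^ i))"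
    by (intro sum.cong) (auto simp: frob_add distrib_left power_mult mult.commute[of 2] power2_eq_square)
  also have "\<dots> = t ^ (2 ^ s) + t"
    using sum_lessThan_telescope[of "\<lambda>i. t ^ (2 ^ i)" s] by simp
  finally have "?A t + ?A (t + 1) = ?A 1 + Witt 0 1"
    using t by (simp add: sum_Witt_add frob_add)
  then have "Q \<xi> (2 * s) t = \<xi> (?A 1 + Witt 0 1)"
    by (simp add: Q_def mult_2 sum_lessThan_add power_add power_mult ts)
  also have "\<dots> = Q \<xi> s 1 * - 1"
    using sum_Witt_in_W2[of 1 s] by (subst xi_add) (auto simp: Q_def xi_Witt_0_1 GF_def)
  also have "Q \<xi> s 1 = \<iota> ^ s"
    using Q_mult_power[of 1 1 s] xi(2) by (simp add: Q_def GF_def)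
  finally show ?thesis by simp
qed

lemma Q_artin_schreier_tower:
  assumes "t ^ (2 ^ s) + t = (1 :: 'k)"
  shows "Q \<xi> (n * (2 * s)) t = (- 1) ^ n * \<iota> ^ (n * s)"
  using assms
  by (simp only: Q_mult_power artin_schreier_in_GF Q_artin_schreier)
    (simp add: power_minus[of "\<iota> ^ s"] mult.commute[of n] power_mult)

text \<open>For \<open>v\<close> in the subfield, the relative trace of \<open>t * v\<close> is
  \<open>v\<close>, so \<open>psi\<close> over degree \<open>2 * s\<close> takes the value
  \<open>psi s v\<close>. Since \<open>Q\<close> of degree \<open>s\<close> squares to
  \<open>psi s\<close>, this is also \<open>Q\<close> of degree \<open>2 * s\<close> at
  \<open>v\<close>; both sides are then raised to the power \<open>n\<close>.\<close>

lemma Q_eq_psi_artin_schreier: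
  assumes t: "t ^ (2 ^ s) + t = (1 :: 'k)" and v: "v \<in> GF (2 ^ s)"
  shows "Q \<xi> (n * (2 * s)) v = psi (n * (2 * s)) (t * v)"
proof -
  have v2: "v \<in> GF (2 ^ (2 * s))"
    using v GF_subset[of "2 ^ s" 2] by (auto simp: mult.commute power_mult)
  have "Tr2 (2 * s) (t * v) = Tr2 s ((t ^ (2 ^ s) + t) * v)"
    using v unfolding Tr2_double by (simp add: power_mult_distrib GF_def algebra_simps)
  then have "psi (2 * s) (t * v) = (psi s v :: 'c)"
    using t by (simp add: psi_def)
  also have "\<dots> = Q \<xi> (2 * s) v"
    using v by (simp add: Q_mult_power Q_mult_self power2_eq_square)
  finally show ?thesis
    using v2 t by (simp add: Q_mult_power psi_mult_power artin_schreier_in_GF)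
qed

section \<open>The quadratic Gauss sum\<close>

lemma sum_GF_shift:
  assumes "N > 0" and "a \<in> GF (2 ^ N)"
  shows "(\<Sum>y\<in>GF (2 ^ N). f (y + a)) = (\<Sum>y\<in>GF (2 ^ N). f (y :: 'k) :: 'd::comm_monoid_add)"
  by (rule sum.reindex_bij_witness[of _ "\<lambda>y. y + a" "\<lambda>y. y + a"]) (use assms in \<open>auto simp: add.assoc\<close>)

text \<open>The Gauss sum is evaluated by averaging over the translations by the maximal isotropic subspace
  \<open>GF (2 ^ m)\<close>, on which \<open>Q\<close> is the linear character given by an Artin-Schreier element \<open>t\<close>; only the
  coset of \<open>t\<close> survives, and \<open>Q\<close> is constant there.\<close>

lemma gauss_sum:
  assumes m: "m > 0"
  shows "(\<Sum>x\<in>GF (2 ^ (2 * m)). Q \<xi> (2 * m) x) = - (2 ^ m * \<iota> ^ m)"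
proof -
  let ?N = "2 * m"
  let ?K = "GF (2 ^ ?N) :: 'k set" and ?L = "GF (2 ^ m) :: 'k set"
  have sub: "v \<in> ?K" if "v \<in> ?L" for v
    using that GF_subset[of "2 ^ m" 2] by (auto simp: mult.commute power_mult)
  obtain t :: 'k where t: "t ^ (2 ^ m) + t = 1"
    using artin_schreier_exists m by blast
  have tK: "t \<in> ?K" using artin_schreier_in_GF t by blast
  have Qv: "Q \<xi> ?N v = psi ?N (t * v)" if "v \<in> ?L" for v
    using Q_eq_psi_artin_schreier[OF t that, of 1] by simp
  have tr: "psi ?N (s * v) = (psi m (v * (s + s ^ (2 ^ m))) :: 'c)" if "v \<in> ?L" for s v
    using that unfolding psi_def Tr2_double
    by (simp add: power_mult_distrib GF_def algebra_simps)
  have in_L: "s + s ^ (2 ^ m) \<in> ?L" if "s \<in> ?K" for s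
  proof -
    have "(s ^ (2 ^ m)) ^ (2 ^ m) = s"
      using that by (simp add: GF_def mult_2 power_add power_mult)
    then show ?thesis by (simp add: GF_def frob_add add.commute)
  qed
  have "2 ^ m * (\<Sum>s\<in>?K. Q \<xi> ?N s) = (\<Sum>v\<in>?L. \<Sum>s\<in>?K. Q \<xi> ?N (s + v))"
    using m sub by (simp add: sum_GF_shift card_GF)
  also have "\<dots> = (\<Sum>s\<in>?K. \<Sum>v\<in>?L. Q \<xi> ?N s * psi m (v * ((t + s) + (t + s) ^ (2 ^ m))))"
    using sub tK
    by (subst sum.swap, intro sum.cong refl)
      (simp add: Q_add Qv mult.assoc flip: psi_add distrib_right tr)
  also have "\<dots> = (\<Sum>s\<in>?K. Q \<xi> ?N s * (if (t + s) + (t + s) ^ (2 ^ m) = 0 then 2 ^ m else 0))"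
    using m in_L tK by (intro sum.cong refl) (simp only: sum_psi GF_add flip: sum_distrib_left)
  \<comment> \<open>Recentring at \<open>t\<close> turns the surviving coset into the subfield
    itself.\<close>
  also have "\<dots> = (\<Sum>s\<in>?K. Q \<xi> ?N (s + t) * (if s + s ^ (2 ^ m) = 0 then 2 ^ m else 0))"
    using m tK by (subst sum_GF_shift[of ?N t, symmetric]) (simp_all add: add.commute)
  also have "\<dots> = (\<Sum>s\<in>?L. Q \<xi> ?N (s + t) * 2 ^ m)"
    using m sub
    by (intro sum.mono_neutral_cong_right) (auto simp: finite_GF add_eq_0_iff_eq GF_def[of "2 ^ m"])
  \<comment> \<open>For \<open>s\<close> in the subfield, \<open>Q\<close> at \<open>s\<close>
    equals \<open>psi ?N (t * s)\<close> and cancels the polarization factor.\<close>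
  also have "\<dots> = (\<Sum>s\<in>?L. Q \<xi> ?N t * 2 ^ m)"
    using sub tK by (intro sum.cong refl) (simp add: Q_add Qv mult.commute[of _ t])
  also have "\<dots> = 2 ^ m * - (2 ^ m * \<iota> ^ m)"
    using m t by (simp add: card_GF Q_artin_schreier)
  finally show ?thesis by (metis mult_left_cancel power_not_zero zero_neq_numeral)
qed

end

section \<open>The additive polynomial and the associated exponential sums\<close>

lemma F_0 [simp]: "p > 0 \<Longrightarrow> F p e b 0 = 0"
  by (simp add: F_def zero_power)

lemma two_power_power: "((2 :: nat) ^ f) ^ i = 2 ^ (f * i)"
  by (simp add: power_mult)

context alg_closed_char_2
begin

lemma F_add: "F (2 ^ f) e b (x + y :: 'k) = F (2 ^ f) e b x + F (2 ^ f) e b y"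
  by (simp add: F_def two_power_power frob_add distrib_left sum.distrib)

lemma F_star_add: "F_star (2 ^ f) e b (x + y :: 'k) = F_star (2 ^ f) e b x + F_star (2 ^ f) e b y"
  by (simp add: F_star_def two_power_power proot_add distrib_left sum.distrib)

lemma F_star_0 [simp]: "F_star (2 ^ f) e b (0 :: 'k) = 0"
  by (simp add: F_star_def two_power_power)

lemma F_in_GF: "\<lbrakk>\<And>i. i \<le> e \<Longrightarrow> b i \<in> GF (2 ^ N); x \<in> GF (2 ^ N)\<rbrakk> \<Longrightarrow> F p e b x \<in> (GF (2 ^ N) :: 'k set)"
  unfolding F_def by (intro GF_sum GF_mult GF_power) auto

lemma F_star_in_GF:
  "\<lbrakk>\<And>i. i \<le> e \<Longrightarrow> b i \<in> GF (2 ^ N); x \<in> GF (2 ^ N)\<rbrakk> \<Longrightarrow> F_star (2 ^ f) e b x \<in> (GF (2 ^ N) :: 'k set)"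
  unfolding F_star_def two_power_power by (intro GF_sum GF_mult GF_proot) auto

lemma proot_mult_power: "proot (2 ^ i) (x * y ^ (2 ^ i)) = proot (2 ^ i) x * (y :: 'k)"
  by (rule proot_eqI) (simp add: power_mult_distrib)

text \<open>The trace is invariant under \<open>p ^ i\<close>-th roots, and such a root turns
  \<open>b i * y * u ^ (p ^ i)\<close> into \<open>u\<close> times the corresponding term of
  \<open>F_star\<close>.\<close>

lemma Tr2_F_adjoint:
  assumes "\<And>i. i \<le> e \<Longrightarrow> b i \<in> GF (2 ^ N)" and "u \<in> GF (2 ^ N)" and "y \<in> (GF (2 ^ N) :: 'k set)"
  shows "Tr2 N (y * F (2 ^ f) e b u) = Tr2 N (u * F_star (2 ^ f) e b y)"
proof -
  have "Tr2 N (y * (b i * u ^ (2 ^ (f * i)))) = Tr2 N (u * proot (2 ^ (f * i)) (b i * y))" if "i \<le> e" for i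
  proof -
    have "Tr2 N (y * (b i * u ^ (2 ^ (f * i)))) = Tr2 N (proot (2 ^ (f * i)) ((b i * y) * u ^ (2 ^ (f * i))))"
      using that assms by (subst Tr2_proot) (auto simp: mult_ac)
    then show ?thesis by (simp add: proot_mult_power mult.commute)
  qed
  then show ?thesis
    by (simp add: F_def F_star_def two_power_power sum_distrib_left Tr2_sum)
qed

text \<open>Both sides equal the trace of the product of the values of \<open>F\<close> at
  \<open>u\<close> and \<open>y\<close>.\<close>

lemma Tr2_E_adjoint:
  assumes "\<And>i. i \<le> e \<Longrightarrow> b i \<in> GF (2 ^ N)" and "u \<in> GF (2 ^ N)" and "y \<in> (GF (2 ^ N) :: 'k set)"
  shows "Tr2 N (y * E_F (2 ^ f) e b u) = Tr2 N (u * E_F (2 ^ f) e b y)"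
proof -
  have "Tr2 N (v * E_F (2 ^ f) e b w) = Tr2 N (F (2 ^ f) e b w * F (2 ^ f) e b v)"
    if "v \<in> GF (2 ^ N)" "w \<in> GF (2 ^ N)" for v w
    unfolding E_F_def using that assms(1) Tr2_F_adjoint F_in_GF by metis
  from this[of y u] this[of u y] show ?thesis
    using assms by (simp add: mult.commute)
qed

text \<open>The \<open>p\<^bsup>e\<^esup>\<close>-th power of \<open>F\<^sup>*\<close> is a separable polynomial of degree \<open>p\<^bsup>e\<^esup>\<close>.\<close>

lemma card_W_star:
  assumes f: "f > 0" and b: "b 0 \<noteq> (0 :: 'k)" "b e \<noteq> 0"
  shows "card (W_star (2 ^ f) e b) = (2 ^ f) ^ e"
proof -
  \<comment> \<open>Taking the power reverses the order of the exponents: \<open>i = e\<close> gives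
    the only linear term, hence the derivative \<open>b e\<close>, and \<open>i = 0\<close> gives
    the leading term.\<close>
  define P where "P = (\<Sum>i\<le>e. monom (b i ^ (2 ^ (f * (e - i)))) (2 ^ (f * (e - i))))"
  have eval: "(F_star (2 ^ f) e b x) ^ (2 ^ (f * e)) = poly P x" for x
  proof -
    have "proot (2 ^ (f * i)) (b i * x) ^ (2 ^ (f * e)) = (b i * x) ^ (2 ^ (f * (e - i)))" if "i \<le> e" for i
    proof -
      have "f * e = f * i + f * (e - i)" using that by (simp flip: distrib_left)
      then have "(2 :: nat) ^ (f * e) = 2 ^ (f * i) * 2 ^ (f * (e - i))"
        by (simp flip: power_add)
      then show ?thesis by (simp only: power_mult[of _ "2 ^ (f * i)"] proot_power)
    qed
    then show ?thesis
      by (simp add: F_star_def P_def two_power_power frob_sum poly_sum poly_monom power_mult_distrib)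
  qed
  have W: "W_star (2 ^ f) e b = {x. poly P x = 0}"
    unfolding W_star_def eval[symmetric] by simp
  have "pderiv P = (\<Sum>i\<le>e. if i = e then [:b e:] else 0)"
    unfolding P_def higher_pderiv_sum[where n = 1, simplified] using f
    by (intro sum.cong) (auto simp: pderiv_monom monom_0 power_0_left)
  then have "pderiv P = [:b e:]" by simp
  then have "card (W_star (2 ^ f) e b) = degree P"
    unfolding W using b card_roots_separable by blast
  moreover have "degree P = 2 ^ (f * e)"
  proof (rule antisym)
    show "degree P \<le> 2 ^ (f * e)"
      unfolding P_def by (intro degree_sum_le) (auto intro!: order.trans[OF degree_monom_le])
    have "coeff P (2 ^ (f * e)) = (\<Sum>i\<le>e. if i = 0 then b 0 ^ (2 ^ (f * e)) else 0)"
      unfolding P_def coeff_sum using f by (intro sum.cong) auto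
    then show "2 ^ (f * e) \<le> degree P"
      using b by (intro le_degree) auto
  qed
  ultimately show ?thesis by (simp add: two_power_power)
qed

text \<open>Raising the summand with root index \<open>j\<close> to the power \<open>p ^ j\<close>
  preserves its trace and makes it a product of two monomials of \<open>F\<close>. So
  \<open>R_F\<close> encodes the second elementary symmetric function of these monomials.\<close>

lemma Tr2_R_F:
  assumes b: "\<And>i. i \<le> e \<Longrightarrow> b i \<in> GF (2 ^ N)" and x: "x \<in> (GF (2 ^ N) :: 'k set)"
  shows "Tr2 N (x * R_F (2 ^ f) e b x)
    = Tr2 N (\<Sum>j\<le>e. \<Sum>i<j. (b i * x ^ (2 ^ (f * i))) * (b j * x ^ (2 ^ (f * j))))"
proof -
  define T where "T i j = Tr2 N ((b i * x ^ (2 ^ (f * i))) * (b j * x ^ (2 ^ (f * j))))" for i j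
  have summand: "Tr2 N (x * (proot (2 ^ (f * j)) (b j * b (j + i)) * x ^ (2 ^ (f * i)))) = T j (j + i)"
    if "j + i \<le> e" for i j
  proof -
    have "(x * (proot (2 ^ (f * j)) (b j * b (j + i)) * x ^ (2 ^ (f * i)))) ^ (2 ^ (f * j))
      = (b j * x ^ (2 ^ (f * j))) * (b (j + i) * x ^ (2 ^ (f * (j + i))))"
      by (simp add: power_mult_distrib power_add mult_ac distrib_left flip: power_mult)
    then show ?thesis
      unfolding T_def using that b x by (subst Tr2_frob[symmetric, where j = "f * j"]) simp_all
  qed
  have "Tr2 N (x * R_F (2 ^ f) e b x) = (\<Sum>i=1..e. \<Sum>j=0..e - i. T j (j + i))"
    unfolding R_F_def R_coeff_def two_power_power sum_distrib_left sum_distrib_right Tr2_sum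
    by (intro sum.cong refl summand) auto
  \<comment> \<open>Pairs given by gap and smaller index become pairs of larger and smaller
    index.\<close>
  also have "\<dots> = (\<Sum>j\<le>e. \<Sum>i<j. T i j)"
    unfolding sum.Sigma[OF finite_atLeastAtMost ballI[OF finite_atLeastAtMost]]
      sum.Sigma[OF finite_atMost ballI[OF finite_lessThan]]
    by (rule sum.reindex_bij_witness[of _ "\<lambda>(j, i). (j - i, i)" "\<lambda>(i, j). (j + i, j)"]) auto
  finally show ?thesis by (simp add: T_def Tr2_sum)
qed

end

text \<open>The element \<open>t0\<close> is only required to lie in \<open>S_F\<close>; the
  Artin-Schreier equation serves to provide such an element and to evaluate \<open>Q\<close> at
  it.\<close>

locale additive_quadratic = witt_character ty \<xi> \<iota>
  for ty :: "'k::alg_closed_field itself" and \<xi> :: "'k witt2 \<Rightarrow> 'c::field_char_0" and \<iota> :: 'c +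
  fixes f e N :: nat and b :: "nat \<Rightarrow> 'k" and t0 :: 'k
  assumes f: "f > 0" and N: "N > 0" and f_dvd_N: "f dvd N"
    and coeffs: "\<And>i. i \<le> e \<Longrightarrow> b i \<in> GF (2 ^ N)"
    and b_nonzero: "b 0 \<noteq> 0" "b e \<noteq> 0"
    and F_star_1: "F_star (2 ^ f) e b 1 = 0"
    and W_star_subset: "W_star (2 ^ f) e b \<subseteq> GF (2 ^ N)"
    and ker_E_subset: "{x. E_F (2 ^ f) e b x = 0} \<subseteq> GF (2 ^ N)"
    and t0_in: "t0 \<in> GF (2 ^ N)"
    and Q_W_star: "\<And>v. v \<in> W_star (2 ^ f) e b \<Longrightarrow> Q \<xi> N v = psi N (t0 * v)"
begin

abbreviation "K \<equiv> GF (2 ^ N) :: 'k set"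
abbreviation "FF \<equiv> F (2 ^ f) e b"
abbreviation "FS \<equiv> F_star (2 ^ f) e b"
abbreviation "EE \<equiv> E_F (2 ^ f) e b"
abbreviation "W \<equiv> W_star (2 ^ f) e b"
abbreviation "RR \<equiv> R_F (2 ^ f) e b"
abbreviation "\<alpha> \<equiv> alpha_F (2 ^ f) e b"
abbreviation "q_form t x \<equiv> x * R_Ft (2 ^ f) e b t x"

definition S :: "'k \<Rightarrow> 'c" where
  "S a = (\<Sum>x\<in>K. psi N (x * (RR x + a * x)))"

lemma FF_in [simp]: "x \<in> K \<Longrightarrow> FF x \<in> K"
  and FS_in [simp]: "x \<in> K \<Longrightarrow> FS x \<in> K"
  by (simp_all add: F_in_GF F_star_in_GF coeffs)

lemma EE_in [simp]: "x \<in> K \<Longrightarrow> EE x \<in> K"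
  by (simp add: E_F_def)

lemma RR_in [simp]: "x \<in> K \<Longrightarrow> RR x \<in> K"
  unfolding R_F_def R_coeff_def two_power_power
  by (intro GF_sum GF_mult GF_power GF_proot coeffs) auto

lemma gamma_in [simp]: "gamma_F (2 ^ f) e b \<in> K"
  unfolding gamma_F_def two_power_power by (intro GF_sum GF_mult GF_proot coeffs) auto

lemma alpha_in [simp]: "t \<in> K \<Longrightarrow> \<alpha> t \<in> K"
  by (simp add: alpha_F_def)

lemma psi_F_adjoint: "u \<in> K \<Longrightarrow> y \<in> K \<Longrightarrow> psi N (y * FF u) = (psi N (u * FS y) :: 'c)"
  by (intro psi_cong Tr2_F_adjoint coeffs)

lemma W_iff: "v \<in> W \<longleftrightarrow> v \<in> K \<and> FS v = 0"
  using W_star_subset by (auto simp: W_star_def)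

text \<open>Since \<open>F\<^sup>*(1) = 0\<close>, expanding \<open>1 = Q(F\<^sup>*(1) x)\<close> eliminates the diagonal terms of \<open>Q(F(x))\<close>.\<close>

lemma Q_FF:
  assumes x: "x \<in> K"
  shows "Q \<xi> N (FF x) = psi N (gamma_F (2 ^ f) e b * x\<^sup>2) * psi N (x * RR x)"
proof -
  let ?c = "\<lambda>i. proot (2 ^ (f * i)) (b i) * x"
  let ?d = "\<lambda>i. b i * x ^ (2 ^ (f * i))"
  have c: "?c i \<in> K" and d: "?d i \<in> K" if "i \<le> e" for i
    using that x coeffs by auto
  have "(\<Sum>i\<le>e. ?c i) = FS 1 * x"
    by (simp add: F_star_def two_power_power sum_distrib_right)
  then have "1 = Q \<xi> N (\<Sum>i\<le>e. ?c i)" by (simp add: F_star_1)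
  also have "\<dots> = (\<Prod>i\<le>e. Q \<xi> N (?c i)) * psi N (\<Sum>j\<le>e. \<Sum>i<j. ?c i * ?c j)"
    by (rule Q_sum) (rule c)
  also have "(\<Sum>j\<le>e. \<Sum>i<j. ?c i * ?c j) = gamma_F (2 ^ f) e b * x\<^sup>2"
    unfolding gamma_F_def two_power_power sum_distrib_right
    by (intro sum.cong refl) (simp add: power2_eq_square mult_ac)
  \<comment> \<open>The terms of \<open>FS 1 * x\<close> and of \<open>FF x\<close> are Frobenius
    conjugate, and \<open>Q\<close> does not distinguish conjugates.\<close>
  also have "(\<Prod>i\<le>e. Q \<xi> N (?c i)) = (\<Prod>i\<le>e. Q \<xi> N (?d i))"
  proof (rule prod.cong[OF refl])
    fix i assume "i \<in> {..e}"
    then have "Q \<xi> N (?c i ^ (2 ^ (f * i))) = Q \<xi> N (?c i)"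
      using c by (intro Q_frob) auto
    then show "Q \<xi> N (?c i) = Q \<xi> N (?d i)"
      by (simp add: power_mult_distrib)
  qed
  finally have "psi N (gamma_F (2 ^ f) e b * x\<^sup>2) = (\<Prod>i\<le>e. Q \<xi> N (?d i))"
    by (simp add: psi_def split: if_splits) (metis minus_minus)
  moreover have "Q \<xi> N (\<Sum>i\<le>e. ?d i)
      = (\<Prod>i\<le>e. Q \<xi> N (?d i)) * psi N (\<Sum>j\<le>e. \<Sum>i<j. ?d i * ?d j)"
    by (rule Q_sum) (rule d)
  moreover have "(psi N (\<Sum>j\<le>e. \<Sum>i<j. ?d i * ?d j) :: 'c) = psi N (x * RR x)"
    using Tr2_R_F[of e b N x f] coeffs x by (intro psi_cong) simp
  ultimately show ?thesis by (simp only: F_def two_power_power)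
qed

text \<open>The part of the form without \<open>t\<close> is the exponent in \<open>Q_FF\<close>.
  The rest is \<open>(x * FS t)\<^sup>2\<close>, whose trace is that of \<open>x * FS t\<close>, and
  adjointness turns this into \<open>t * FF x\<close>.\<close>

lemma psi_q_form:
  assumes "t \<in> K" and "x \<in> K"
  shows "psi N (q_form t x) = Q \<xi> N (FF x) * psi N (t * FF x)"
proof -
  have "q_form t x = gamma_F (2 ^ f) e b * x\<^sup>2 + x * RR x + (x * FS t)\<^sup>2"
    by (simp add: R_Ft_def alpha_F_def power2_eq_square algebra_simps)
  then have "psi N (q_form t x) = Q \<xi> N (FF x) * psi N ((x * FS t)\<^sup>2)"
    using assms by (simp add: psi_add Q_FF)
  also have "psi N ((x * FS t)\<^sup>2) = (psi N (t * FF x) :: 'c)"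
    using assms by (simp add: psi_sq psi_F_adjoint)
  finally show ?thesis .
qed

lemma S_alpha: "S (\<alpha> t) = (\<Sum>x\<in>K. psi N (q_form t x))"
  by (simp add: S_def R_Ft_def)

lemma psi_q_form_add:
  assumes "x \<in> K" and "u \<in> K"
  shows "psi N (q_form t0 (x + u)) = (psi N (q_form t0 x) * psi N (q_form t0 u) * psi N (FF x * FF u) :: 'c)"
  using assms t0_in by (simp add: psi_q_form F_add distrib_left psi_add Q_add)

lemma alpha_add_F: "\<alpha> (t + FF u) = \<alpha> t + (EE u)\<^sup>2"
  by (simp add: alpha_F_def F_star_add E_F_def sq_add add.assoc)

lemma Q_t0_F: "u \<in> K \<Longrightarrow> Q \<xi> N (t0 + FF u) = Q \<xi> N t0 * psi N (q_form t0 u)"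
  using t0_in by (simp add: Q_add psi_q_form)

text \<open>By \<open>alpha_add_F\<close> the left side is the sum for \<open>t0 + FF u\<close>.
  Changing \<open>t0\<close> by \<open>FF u\<close> inserts the polarization factor, so it acts like
  translating \<open>x\<close> by \<open>u\<close>, up to the constant sign
  \<open>psi N (q_form t0 u)\<close>.\<close>

lemma S_shift:
  assumes u: "u \<in> K"
  shows "S (\<alpha> t0 + (EE u)\<^sup>2) = psi N (q_form t0 u) * S (\<alpha> t0)"
proof -
  have "psi N (q_form (t0 + FF u) x) = (psi N (q_form t0 u) * psi N (q_form t0 (x + u)) :: 'c)"
    if x: "x \<in> K" for x
  proof -
    let ?\<psi> = "psi N :: 'k \<Rightarrow> 'c"
    have "?\<psi> (q_form (t0 + FF u) x) = ?\<psi> (q_form t0 x) * ?\<psi> (FF x * FF u)"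
      using x u t0_in by (simp add: psi_q_form distrib_right psi_add mult.commute[of "FF u"])
    \<comment> \<open>The square of a sign is inserted in order to complete the translated
      form.\<close>
    also have "\<dots> = (?\<psi> (q_form t0 u) * ?\<psi> (q_form t0 u)) * (?\<psi> (q_form t0 x) * ?\<psi> (FF x * FF u))"
      by (simp only: psi_mult_self mult_1_left)
    also have "\<dots> = ?\<psi> (q_form t0 u) * ?\<psi> (q_form t0 (x + u))"
      using psi_q_form_add[OF x u] by (simp only: mult_ac)
    finally show ?thesis .
  qed
  then have "S (\<alpha> (t0 + FF u)) = (\<Sum>x\<in>K. psi N (q_form t0 u) * psi N (q_form t0 (x + u)))"
    by (simp add: S_alpha)
  also have "\<dots> = psi N (q_form t0 u) * S (\<alpha> t0)"
    using N u sum_GF_shift[of N u "\<lambda>x. psi N (q_form t0 x) :: 'c"]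
    by (simp add: S_alpha flip: sum_distrib_left)
  finally show ?thesis by (simp add: alpha_add_F)
qed

text \<open>The factor in front makes each summand \<open>Q \<xi> N (t0 + FF x)\<close>. Grouping by
  fibres of \<open>FF\<close> introduces a sum over \<open>W\<close>; after shifting by
  \<open>t0\<close>, the hypothesis on \<open>W\<close> absorbs the factor
  \<open>psi N (y * (z + t0))\<close> into \<open>Q \<xi> N (z + y)\<close>. Each \<open>y\<close>
  thus contributes a full Gauss sum.\<close>

lemma S_alpha_t0: "Q \<xi> N t0 * S (\<alpha> t0) = (2 ^ f) ^ e * (\<Sum>x\<in>K. Q \<xi> N x)"
proof -
  note fin = finite_GF[OF N]
  have "Q \<xi> N t0 * S (\<alpha> t0) = (\<Sum>x\<in>K. Q \<xi> N (t0 + FF x))"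
    by (simp add: S_alpha Q_t0_F sum_distrib_left)
  also have "\<dots> = (\<Sum>z\<in>K. \<Sum>x | x \<in> K \<and> FF x = z. Q \<xi> N (t0 + FF x))"
    using fin by (subst sum.group) auto
  also have "\<dots> = (\<Sum>z\<in>K. of_nat (card {x \<in> K. FF x = z}) * Q \<xi> N (t0 + z))"
    by (intro sum.cong refl) simp
  also have "\<dots> = (\<Sum>z\<in>K. \<Sum>y\<in>W. psi N (y * z) * Q \<xi> N (t0 + z))"
  proof (intro sum.cong refl)
    fix z assume "z \<in> K"
    then have "of_nat (card {x \<in> K. FF x = z}) = (\<Sum>y | y \<in> K \<and> FS y = 0. psi N (y * z) :: 'c)"
      using N by (intro card_fibre Tr2_F_adjoint coeffs) auto
    also have "{y. y \<in> K \<and> FS y = 0} = W" by (auto simp: W_iff)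
    finally show "of_nat (card {x \<in> K. FF x = z}) * Q \<xi> N (t0 + z) = (\<Sum>y\<in>W. psi N (y * z) * Q \<xi> N (t0 + z))"
      by (simp add: sum_distrib_right)
  qed
  also have "\<dots> = (\<Sum>y\<in>W. \<Sum>z\<in>K. psi N (y * z) * Q \<xi> N (t0 + z))"
    by (rule sum.swap)
  also have "\<dots> = (\<Sum>y\<in>W. \<Sum>z\<in>K. psi N (y * (z + t0)) * Q \<xi> N z)"
  proof (rule sum.cong[OF refl])
    fix y
    have "(\<Sum>z\<in>K. psi N (y * (z + t0)) * Q \<xi> N z) = (\<Sum>z\<in>K. psi N (y * (z + t0 + t0)) * Q \<xi> N (z + t0))"
      using sum_GF_shift[OF N t0_in, of "\<lambda>z. psi N (y * (z + t0)) * Q \<xi> N z"] by simp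
    then show "(\<Sum>z\<in>K. psi N (y * z) * Q \<xi> N (t0 + z)) = (\<Sum>z\<in>K. psi N (y * (z + t0)) * Q \<xi> N z)"
      by (simp add: add.assoc add.commute[of t0])
  qed
  also have "\<dots> = (\<Sum>y\<in>W. \<Sum>z\<in>K. Q \<xi> N (z + y))"
    using t0_in
    by (intro sum.cong refl) (auto simp: W_iff Q_W_star Q_add distrib_left psi_add mult_ac)
  also have "\<dots> = (\<Sum>y\<in>W. \<Sum>z\<in>K. Q \<xi> N z)"
    using N by (intro sum.cong refl sum_GF_shift) (auto simp: W_iff)
  also have "\<dots> = (2 ^ f) ^ e * (\<Sum>x\<in>K. Q \<xi> N x)"
    using f b_nonzero by (simp add: card_W_star)
  finally show ?thesis .
qed

text \<open>Translating \<open>x\<close> by an element \<open>w\<close> of the kernel of \<open>E\<close> multiplies the summand of \<open>S a\<close> by \<open>\<psi>(dw)\<close>, so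
  that the sum vanishes unless \<open>d\<close> is orthogonal to the kernel of the self-adjoint map \<open>E\<close>.\<close>

lemma S_nonzero_imp:
  assumes a: "a \<in> K" and S: "S a \<noteq> 0"
  shows "\<exists>u\<in>K. a = \<alpha> t0 + (EE u)\<^sup>2"
proof -
  \<comment> \<open>With a square root, the deviation of \<open>a\<close> from
    \<open>\<alpha> t0\<close> contributes only the linear character
    \<open>psi N (x * d)\<close>.\<close>
  define d where "d = proot 2 (a + \<alpha> t0)"
  have "d\<^sup>2 = a + \<alpha> t0" using proot_power[of 1] by (simp add: d_def)
  then have a_eq: "a = \<alpha> t0 + d\<^sup>2" by (simp add: add.left_commute)
  have d: "d \<in> K" using a t0_in GF_proot[of _ _ 1] by (simp add: d_def)
  have summand: "psi N (x * (RR x + a * x)) = (psi N (q_form t0 x) * psi N (x * d) :: 'c)" if "x \<in> K" for x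
  proof -
    have "x * (RR x + a * x) = q_form t0 x + (x * d)\<^sup>2"
      by (simp add: a_eq R_Ft_def power2_eq_square algebra_simps)
    then show ?thesis using that d t0_in by (simp add: psi_add psi_sq R_Ft_def)
  qed
  have "psi N (w * d) = (1 :: 'c)" if w: "w \<in> K" "EE w = 0" for w
  proof (rule ccontr)
    assume *: "psi N (w * d) \<noteq> (1 :: 'c)"
    \<comment> \<open>On \<open>W\<close> the two factors in \<open>psi_q_form\<close> agree, so the
      form is trivial at \<open>w\<close>; the polar term with \<open>w\<close> is trivial because
      it is \<open>psi N (x * EE w)\<close>.\<close>
    have "FF w \<in> W" using w by (simp add: W_iff E_F_def)
    then have "psi N (q_form t0 w) = (1 :: 'c)"
      using w t0_in by (simp add: psi_q_form Q_W_star)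
    moreover have "psi N (FF x * FF w) = (1 :: 'c)" if "x \<in> K" for x
      using psi_F_adjoint[of x "FF w"] that w by (simp add: mult.commute[of _ "FF w"] flip: E_F_def)
    ultimately have "psi N ((x + w) * (RR (x + w) + a * (x + w)))
        = (psi N (w * d) * psi N (x * (RR x + a * x)) :: 'c)" if "x \<in> K" for x
      using that w d by (simp only: summand GF_add psi_q_form_add distrib_right[of x w d] psi_add GF_mult)
        (simp add: mult_ac)
    then have "S a = 0"
      unfolding S_def using w * N
      by (intro sum_shift_eq_0[of _ w _ "psi N (w * d)"]) (auto simp: finite_GF)
    with S show False ..
  qed
  then obtain u where "u \<in> K" "EE u = d"
    using range_iff_psi_kernel[of N EE EE d, where ?'c = 'c] N d Tr2_E_adjoint[OF coeffs] 
    by (auto simp: E_F_def)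
  with a_eq show ?thesis by blast
qed

text \<open>Two elements represent \<open>Q\<close> on \<open>W\<close> simultaneously exactly when
  their difference is orthogonal to \<open>W\<close>, the kernel of \<open>FS\<close>, that is, when
  it lies in the range of the adjoint \<open>FF\<close>.\<close>

lemma S_F_eq: "S_F \<xi> N (2 ^ f) e b = {t0 + FF u | u. u \<in> K}"
proof -
  have "t \<in> S_F \<xi> N (2 ^ f) e b \<longleftrightarrow> (\<exists>u\<in>K. FF u = t + t0)" if t: "t \<in> K" for t
  proof -
    have "psi N (y * (t + t0)) = (1 :: 'c) \<longleftrightarrow> Q \<xi> N y = psi N (t * y)" if "y \<in> W" for y
      using that t t0_in by (auto simp: W_iff Q_W_star distrib_left psi_add mult.commute[of y])
        (metis mult.left_neutral mult.assoc mult.right_neutral psi_mult_self)+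
    then have "t \<in> S_F \<xi> N (2 ^ f) e b \<longleftrightarrow> (\<forall>y\<in>K. FS y = 0 \<longrightarrow> psi N (y * (t + t0)) = (1 :: 'c))"
      using t by (auto simp: S_F_def W_iff)
    also have "\<dots> \<longleftrightarrow> (\<exists>u\<in>K. FF u = t + t0)"
      using t t0_in N by (intro range_iff_psi_kernel[symmetric] Tr2_F_adjoint coeffs) auto
    finally show ?thesis .
  qed
  moreover have "t \<in> K" if "t \<in> S_F \<xi> N (2 ^ f) e b" for t
    using that by (simp add: S_F_def)
  moreover have "FF u = t + t0 \<longleftrightarrow> t = t0 + FF u" for t u
    by (metis add.commute add_self_left)
  ultimately show ?thesis using t0_in by auto
qed

section \<open>From exponential sums to point counts\<close>

lemma R_F_homogeneous: "c \<in> GF (2 ^ f) \<Longrightarrow> RR (c * x) = c * RR x"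
proof -
  assume "c \<in> GF (2 ^ f)"
  then have "c ^ ((2 ^ f) ^ i) = c" for i
    using GF_subset[of "2 ^ f" i] by (auto simp: GF_def)
  then show ?thesis
    by (simp add: R_F_def power_mult_distrib sum_distrib_left mult_ac)
qed

text \<open>The solutions \<open>y\<close> over each \<open>x\<close> are counted by
  \<open>card_fibre\<close>: the adjoint of \<open>y ^ p - y\<close> is \<open>c\<close> plus its
  \<open>p\<close>-th root, with kernel the field of \<open>p\<close> elements. There
  \<open>c = 0\<close> contributes the main term and every other \<open>c\<close> the same sum
  \<open>S a\<close>.\<close>

lemma card_C_points:
  assumes a: "a \<in> K"
  shows "of_nat (card (C_points (2 ^ f) (2 ^ N) RR a)) = 2 ^ N + (2 ^ f - 1) * S a"
proof -
  note fin = finite_GF[OF N]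
  let ?k = "GF (2 ^ f) :: 'k set"
  define z where "z x = x * (RR x + a * x)" for x
  have z: "z x \<in> K" if "x \<in> K" for x
    using that a by (simp add: z_def)
  have sub: "?k \<subseteq> K"
    using f_dvd_N GF_subset[of "2 ^ f" "N div f"] by (simp flip: power_mult)
  have "C_points (2 ^ f) (2 ^ N) RR a = Sigma K (\<lambda>x. {y \<in> K. y ^ 2 ^ f - y = z x})"
    by (auto simp: C_points_def z_def)
  then have "of_nat (card (C_points (2 ^ f) (2 ^ N) RR a))
    = (\<Sum>x\<in>K. of_nat (card {y \<in> K. y ^ 2 ^ f - y = z x}) :: 'c)"
    using fin by simp
  also have "\<dots> = (\<Sum>x\<in>K. \<Sum>c\<in>?k. psi N (c * z x))"
  proof (intro sum.cong refl)
    fix x assume x: "x \<in> K"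
    have "of_nat (card {y \<in> K. y ^ 2 ^ f - y = z x})
      = (\<Sum>c | c \<in> K \<and> proot (2 ^ f) c + c = 0. psi N (c * z x) :: 'c)"
    proof (rule card_fibre)
      fix y c assume "y \<in> K" "c \<in> K"
      then have "Tr2 N (c * y ^ 2 ^ f) = Tr2 N (proot (2 ^ f) c * y)"
        using Tr2_proot[of "c * y ^ 2 ^ f" N f] by (simp add: proot_mult_power)
      then show "Tr2 N (c * (y ^ 2 ^ f - y)) = Tr2 N (y * (proot (2 ^ f) c + c))"
        by (simp add: distrib_left Tr2_add mult.commute)
    qed (use N z x in auto)
    also have "{c. c \<in> K \<and> proot (2 ^ f) c + c = 0} = ?k"
      using sub proot_power[of f] by (auto simp: add_eq_0_iff_eq GF_def[of "2 ^ f"] intro: proot_eqI) (metis proot_power)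
    finally show "of_nat (card {y \<in> K. y ^ 2 ^ f - y = z x}) = (\<Sum>c\<in>?k. psi N (c * z x) :: 'c)" .
  qed
  also have "\<dots> = (\<Sum>c\<in>?k. \<Sum>x\<in>K. psi N (c * z x))"
    by (rule sum.swap)
  also have "\<dots> = (\<Sum>c\<in>?k. if c = 0 then 2 ^ N else S a)"
  proof (intro sum.cong refl)
    fix c assume c: "c \<in> ?k"
    show "(\<Sum>x\<in>K. psi N (c * z x)) = (if c = 0 then 2 ^ N else S a)"
    proof (cases "c = 0")
      case False
      \<comment> \<open>By homogeneity \<open>z (d * x)\<close> is \<open>d\<^sup>2 * z x\<close>,
        so the factor \<open>c\<close> is removed by rescaling \<open>x\<close>.\<close>
      define d where "d = proot 2 c"
      have d: "d \<in> ?k" "d * d = c"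
        using GF_proot[OF c, of 1] proot_power[of 1 c] by (auto simp: d_def power2_eq_square)
      have d0: "d \<noteq> 0" using d False by auto
      have "c * z x = z (d * x)" for x
        using d by (simp add: z_def R_F_homogeneous algebra_simps flip: d(2))
      then have "(\<Sum>x\<in>K. psi N (c * z x)) = (\<Sum>x\<in>K. psi N (z (d * x)) :: 'c)" by simp
      also have "\<dots> = (\<Sum>x\<in>K. psi N (z x))"
        by (rule sum.reindex_bij_witness[of _ "\<lambda>x. inverse d * x" "\<lambda>x. d * x"])
          (use d d0 sub in \<open>auto simp flip: mult.assoc\<close>)
      finally show ?thesis using False by (simp add: S_def z_def)
    qed (use N in \<open>simp add: card_GF\<close>)
  qed
  also have "\<dots> = 2 ^ N + (2 ^ f - 1) * S a"
  proof -
    have "of_nat (card (?k - {0})) = (2 ^ f - 1 :: 'c)"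
      using f by (simp add: card_GF card_Diff_singleton of_nat_diff)
    then show ?thesis
      using f by (subst sum.remove[of _ 0]) (auto simp: finite_GF)
  qed
  finally show ?thesis .
qed

end

section \<open>Evaluation of the signs and determination of the sets\<close>

theorem theorem6p5:
  fixes b :: "nat \<Rightarrow> 'k::alg_closed_field"
    and \<iota> :: "'c::{field_char_0,alg_closed_field}"
    and \<xi> :: "'k witt2 \<Rightarrow> 'c"
    and l p q q1 n N e :: nat
  assumes p: "\<exists>f\<ge>1. p = 2 ^ f"
    and q: "\<exists>m\<ge>1. q = p ^ m"
    and q1: "\<exists>s\<ge>1. q1 = p ^ s"
    and q1_sq_dvd: "q1\<^sup>2 dvd q"
    and n: "q = q1 ^ (2 * n)"
    and N: "q = 2 ^ N"
    and char_k: "CHAR('k) = 2"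
    and closure_k: "algebraic_extension (GF q :: 'k set)"
    and l: "prime l" "odd l"
    and closure_c: "is_padic_alg_closure l TYPE('c)"
    and iota: "\<iota> ^ 4 = 1" "\<forall>j. 0 < j \<and> j < 4 \<longrightarrow> \<iota> ^ j \<noteq> 1"
    and xi: "is_character_on (W2 (GF 2)) \<xi>" "\<xi> (Witt 1 0) = \<iota>"
    and e: "e \<ge> 1"
    and coeffs: "\<forall>i\<le>e. b i \<in> GF q"
    and i: "b 0 * b e \<noteq> 0"
    and ii: "F_star p e b 1 = 0"
    and iii: "W_star p e b \<subseteq> GF q"
    and iv: "{x. F_star p e b (F p e b x) = 0} \<subseteq> GF q"
    and W_star_q1: "W_star p e b \<subseteq> GF q1"
  shows "(\<exists>t0 \<in> GF (q1\<^sup>2). t0 ^ q1 + t0 = (1::'k))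
    \<and> (\<forall>t0 \<in> GF (q1\<^sup>2). t0 ^ q1 + t0 = 1 \<longrightarrow>
          S_F \<xi> N p e b = {t0 + F p e b u | u. u \<in> GF q}
        \<and> T_max p q e (R_F p e b) \<union> T_min p q e (R_F p e b)
            = {alpha_F p e b t0 + (E_F p e b u)\<^sup>2 | u. u \<in> GF q})
    \<and> (\<forall>t0 \<in> GF (q1\<^sup>2). t0 ^ q1 + t0 = 1 \<longrightarrow>
          S_F_minus \<iota> \<xi> N p e b
            = {t0 + F p e b u | u. u \<in> GF q \<and> Tr2 N (u * R_Ft p e b t0 u) = of_nat (n + 1)}
        \<and> T_max p q e (R_F p e b)
            = {alpha_F p e b t0 + (E_F p e b u)\<^sup>2 | u.
                 u \<in> GF q \<and> Tr2 N (u * R_Ft p e b t0 u) = of_nat (n + 1)})"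
proof -
  obtain f where f: "f \<ge> 1" "p = 2 ^ f" using p by blast
  obtain m where m: "m \<ge> 1" "q = p ^ m" using q by blast
  obtain s' where s': "s' \<ge> 1" "q1 = p ^ s'" using q1 by blast
  note p_q = f(2) N
  define s where "s = f * s'"
  have s: "s > 0" "q1 = 2 ^ s"
    using f s' by (auto simp: s_def power_mult)
  have "(2 :: nat) ^ N = 2 ^ (f * m)"
    using m f N by (simp add: power_mult)
  then have N_fm: "N = f * m" by simp
  have "(2 :: nat) ^ N = 2 ^ (n * (2 * s))"
    using n N s by (simp add: mult_ac flip: power_mult)
  then have N_eq: "N = n * (2 * s)" by simp
  have N0: "N > 0" using N_fm f m by simp
  with N_eq have n0: "n > 0" by (cases n) auto
  have N_half: "N = 2 * (n * s)" using N_eq by simp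
  have "(\<iota>\<^sup>2 - 1) * (\<iota>\<^sup>2 + 1) = \<iota> ^ 4 - 1" by (simp add: algebra_simps flip: power_add)
  then have "\<iota>\<^sup>2 = - 1" using iota by (auto simp: eq_neg_iff_add_eq_0)
  interpret witt_character "TYPE('k)" \<xi> \<iota>
    by unfold_locales (fact char_k \<open>\<iota>\<^sup>2 = - 1\<close> xi)+
  have q1_sq: "q1\<^sup>2 = 2 ^ (2 * s)" by (simp add: s mult.commute flip: power_mult)
  have iota0: "\<iota> \<noteq> 0" using iota by auto
  \<comment> \<open>In characteristic 2, \<open>of_nat (n + 1)\<close> is the parity of
    \<open>n + 1\<close>, so the congruence becomes an equation of signs.\<close>
  have Tr2_iff: "Tr2 N x = of_nat (n + 1) \<longleftrightarrow> psi N x = ((- 1) ^ (n + 1) :: 'c)"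
    if "x \<in> GF q" for x :: 'k
  proof -
    have "of_nat (n + 1) = (if odd n then 0 else 1 :: 'k)"
      by (induction n) auto
    then show ?thesis using Tr2_cases[of x N] that by (auto simp: psi_def N)
  qed
  have ex: "\<exists>t0 \<in> GF (q1\<^sup>2). t0 ^ q1 + t0 = (1::'k)"
    unfolding q1_sq unfolding s(2) using artin_schreier_exists[OF s(1)] artin_schreier_in_GF by blast
  have main: "S_F \<xi> N p e b = {t0 + F p e b u | u. u \<in> GF q}
      \<and> T_max p q e (R_F p e b) \<union> T_min p q e (R_F p e b)
          = {alpha_F p e b t0 + (E_F p e b u)\<^sup>2 | u. u \<in> GF q}
      \<and> S_F_minus \<iota> \<xi> N p e b
          = {t0 + F p e b u | u. u \<in> GF q \<and> Tr2 N (u * R_Ft p e b t0 u) = of_nat (n + 1)}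
      \<and> T_max p q e (R_F p e b)
          = {alpha_F p e b t0 + (E_F p e b u)\<^sup>2 | u.
               u \<in> GF q \<and> Tr2 N (u * R_Ft p e b t0 u) = of_nat (n + 1)}"
    if t0_q1: "t0 \<in> GF (q1\<^sup>2)" and t0: "t0 ^ q1 + t0 = 1" for t0
  proof -
    have t0': "t0 ^ (2 ^ s) + t0 = 1" using t0 s by simp
    have t0_in: "t0 \<in> GF (2 ^ N)"
      using artin_schreier_in_GF[OF t0'] GF_subset[of "2 ^ (2 * s)" n]
      by (auto simp: N_eq mult.commute[of n] power_mult)
    interpret additive_quadratic "TYPE('k)" \<xi> \<iota> f e N b t0
    proof unfold_locales
      show "Q \<xi> N v = psi N (t0 * v)" if "v \<in> W_star (2 ^ f) e b" for v
        unfolding N_eq using that W_star_q1 by (intro Q_eq_psi_artin_schreier t0') (auto simp: f s)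
    qed (use f N0 N_fm coeffs i ii iii iv t0_in in \<open>auto simp: E_F_def N\<close>)
    \<comment> \<open>This is \<open>p ^ e\<close> times the square root of \<open>q\<close>, taken
      in the field of character values.\<close>
    define r :: 'c where "r = (2 ^ f) ^ e * 2 ^ (n * s)"
    have r0: "r \<noteq> 0" by (simp add: r_def)
    have Q_t0: "Q \<xi> N t0 = (- 1) ^ n * \<iota> ^ (n * s)"
      unfolding N_eq by (rule Q_artin_schreier_tower[OF t0'])
    \<comment> \<open>Both \<open>Q\<close> at \<open>t0\<close> and the Gauss sum carry the factor
      \<open>\<iota> ^ (n * s)\<close>; cancelling it leaves the sum equal to \<open>r\<close> up to
      the sign \<open>(- 1) ^ (n + 1)\<close>.\<close>
    have "((- 1) ^ n * \<iota> ^ (n * s)) * S (\<alpha> t0) = (2 ^ f) ^ e * - (2 ^ (n * s) * \<iota> ^ (n * s))"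
      using S_alpha_t0 gauss_sum[of "n * s"] n0 s(1) unfolding Q_t0 by (simp flip: N_half)
    then have "\<iota> ^ (n * s) * ((- 1) ^ n * S (\<alpha> t0)) = \<iota> ^ (n * s) * - r"
      by (simp add: r_def mult_ac)
    then have "(- 1) ^ n * S (\<alpha> t0) = - r"
      using iota0 by (metis mult_left_cancel power_not_zero)
    then have S_t0: "S (\<alpha> t0) = (- 1) ^ (n + 1) * r"
      by (cases "even n") (auto simp: minus_equation_iff)
    have S_t: "S (\<alpha> t0 + (EE u)\<^sup>2) = psi N (q_form t0 u) * (- 1) ^ (n + 1) * r" if "u \<in> K" for u
      using S_shift[OF that] S_t0 by simp
    have sqrt_q: "sqrt (real q) = 2 ^ (n * s)"
      unfolding p_q N_half by (intro real_sqrt_unique) (auto simp: mult.commute simp flip: power_mult)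
    have p1: "(2 :: 'c) ^ f - 1 \<noteq> 0"
    proof -
      have "(2 :: nat) ^ f \<noteq> 1" using f by auto
      then show ?thesis by (metis eq_iff_diff_eq_0 of_nat_1 of_nat_eq_iff of_nat_numeral of_nat_power)
    qed
    \<comment> \<open>The real equation for the count is an equation of natural numbers, which
      transfers to the field of character values.\<close>
    have T_max: "a \<in> T_max p q e RR \<longleftrightarrow> a \<in> K \<and> S a = r" for a
    proof -
      let ?c = "card (C_points p q RR a)"
      have "real ?c = real q + (real p - 1) * real p ^ e * sqrt (real q)
        \<longleftrightarrow> real ?c = real (q + (p - 1) * p ^ e * 2 ^ (n * s))"
        unfolding sqrt_q using p_q by (simp add: of_nat_diff)
      also have "\<dots> \<longleftrightarrow> of_nat ?c = (of_nat (q + (p - 1) * p ^ e * 2 ^ (n * s)) :: 'c)"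
        by (simp only: of_nat_eq_iff)
      also have "\<dots> \<longleftrightarrow> of_nat ?c = 2 ^ N + (2 ^ f - 1) * r"
        using p_q by (simp add: r_def of_nat_diff mult.assoc)
      finally show ?thesis
        using card_C_points[of a] p1 by (auto simp: T_max_def p_q)
    qed
    have T_min: "a \<in> T_min p q e RR \<longleftrightarrow> a \<in> K \<and> S a = - r" for a
    proof -
      let ?c = "card (C_points p q RR a)"
      have "real ?c = real q - (real p - 1) * real p ^ e * sqrt (real q)
        \<longleftrightarrow> real (?c + (p - 1) * p ^ e * 2 ^ (n * s)) = real q"
        unfolding sqrt_q using p_q by (simp add: of_nat_diff eq_diff_eq)
      also have "\<dots> \<longleftrightarrow> of_nat (?c + (p - 1) * p ^ e * 2 ^ (n * s)) = (of_nat q :: 'c)"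
        by (simp only: of_nat_eq_iff)
      also have "\<dots> \<longleftrightarrow> of_nat ?c = 2 ^ N + (2 ^ f - 1) * - r"
        using p_q by (simp add: r_def of_nat_diff mult.assoc eq_diff_eq)
      finally have *: "real ?c = real q - (real p - 1) * real p ^ e * sqrt (real q)
        \<longleftrightarrow> of_nat ?c = 2 ^ N + (2 ^ f - 1) * - r" .
      have "(2 ^ f - 1) * S a = (2 ^ f - 1) * - r \<longleftrightarrow> S a = - r"
        using p1 mult_left_cancel by blast
      then show ?thesis
        unfolding T_min_def mem_Collect_eq * using card_C_points[of a]
        by (auto simp: p_q simp del: mult_minus_right)
    qed
    have psi_cases: "psi N x = (1 :: 'c) \<or> psi N x = (- 1 :: 'c)" for x :: 'k
      by (simp add: psi_def)
    have psi_iff: "psi N x = ((- 1) ^ (n + 1) :: 'c) \<longleftrightarrow> psi N x * (- 1) ^ (n + 1) = (1 :: 'c)" for x :: 'k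
      using psi_cases[of x] by (cases "even n") auto
    have psi_iff': "psi N x * (- 1) ^ n = (- 1 :: 'c) \<longleftrightarrow> psi N x = ((- 1) ^ (n + 1) :: 'c)" for x :: 'k
      using psi_cases[of x] by (cases "even n") auto
    have q_form_in: "q_form t0 u \<in> K" if "u \<in> K" for u
      using that t0_in by (simp add: R_Ft_def)
    have sgn: "\<exists>u\<in>K. a = \<alpha> t0 + (EE u)\<^sup>2" if "a \<in> K" "S a = r \<or> S a = - r" for a
      using that r0 by (intro S_nonzero_imp) auto
    have S_cases: "S (\<alpha> t0 + (EE u)\<^sup>2) = r \<or> S (\<alpha> t0 + (EE u)\<^sup>2) = - r" if "u \<in> K" for u
      using S_t[OF that] psi_cases[of "q_form t0 u"] by (cases "even n") auto
    have S_iff: "S (\<alpha> t0 + (EE u)\<^sup>2) = r \<longleftrightarrow> Tr2 N (q_form t0 u) = of_nat (n + 1)" if "u \<in> K" for u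
    proof -
      have "S (\<alpha> t0 + (EE u)\<^sup>2) = r \<longleftrightarrow> psi N (q_form t0 u) * (- 1) ^ (n + 1) = (1 :: 'c)"
        unfolding S_t[OF that] mult_cancel_right2 using r0 by simp
      also have "\<dots> \<longleftrightarrow> psi N (q_form t0 u) = ((- 1) ^ (n + 1) :: 'c)"
        by (rule psi_iff[symmetric])
      also have "\<dots> \<longleftrightarrow> Tr2 N (q_form t0 u) = of_nat (n + 1)"
        using Tr2_iff[of "q_form t0 u"] q_form_in[OF that] by (simp add: p_q)
      finally show ?thesis .
    qed
    have in_K: "\<alpha> t0 + (EE u)\<^sup>2 \<in> K" if "u \<in> K" for u
      using that t0_in by simp
    have Q_iff: "Q \<xi> N (t0 + FF u) = - (\<iota> ^ (N div 2)) \<longleftrightarrow> Tr2 N (q_form t0 u) = of_nat (n + 1)"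
      if "u \<in> K" for u
    proof -
      \<comment> \<open>The same sign \<open>psi N (q_form t0 u)\<close> governs \<open>Q\<close> at
        \<open>t0 + FF u\<close> and the sum at \<open>\<alpha> t0 + (EE u)\<^sup>2\<close>, so both
        sets have one parity condition.\<close>
      have "Q \<xi> N (t0 + FF u) = (psi N (q_form t0 u) * (- 1) ^ n) * \<iota> ^ (n * s)"
        using Q_t0_F[OF that] Q_t0 by (simp add: mult_ac)
      moreover have "- (\<iota> ^ (N div 2)) = - 1 * \<iota> ^ (n * s)"
        by (simp add: N_half)
      ultimately have "Q \<xi> N (t0 + FF u) = - (\<iota> ^ (N div 2)) \<longleftrightarrow> psi N (q_form t0 u) * (- 1) ^ n = (- 1 :: 'c)"
        by (simp only: mult_right_cancel[OF power_not_zero[OF iota0]])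
      also have "\<dots> \<longleftrightarrow> psi N (q_form t0 u) = ((- 1) ^ (n + 1) :: 'c)"
        by (rule psi_iff')
      also have "\<dots> \<longleftrightarrow> Tr2 N (q_form t0 u) = of_nat (n + 1)"
        using Tr2_iff[of "q_form t0 u"] q_form_in[OF that] by (simp add: p_q)
      finally show ?thesis .
    qed
    show ?thesis
    proof (intro conjI)
      show "S_F \<xi> N p e b = {t0 + F p e b u | u. u \<in> GF q}"
        unfolding p_q by (rule S_F_eq)
      show "S_F_minus \<iota> \<xi> N p e b
          = {t0 + F p e b u | u. u \<in> GF q \<and> Tr2 N (u * R_Ft p e b t0 u) = of_nat (n + 1)}"
        unfolding S_F_minus_def p_q S_F_eq by (auto simp only: mem_Collect_eq Q_iff)
      show "T_max p q e (R_F p e b) \<union> T_min p q e (R_F p e b)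
          = {alpha_F p e b t0 + (E_F p e b u)\<^sup>2 | u. u \<in> GF q}"
      proof (intro set_eqI iffI)
        fix a assume "a \<in> T_max p q e (R_F p e b) \<union> T_min p q e (R_F p e b)"
        then have "a \<in> K" "S a = r \<or> S a = - r"
          using T_max[of a] T_min[of a] unfolding p_q by auto
        from sgn[OF this] show "a \<in> {alpha_F p e b t0 + (E_F p e b u)\<^sup>2 | u. u \<in> GF q}"
          unfolding p_q by auto
      next
        fix a assume "a \<in> {alpha_F p e b t0 + (E_F p e b u)\<^sup>2 | u. u \<in> GF q}"
        then obtain u where u: "u \<in> K" "a = \<alpha> t0 + (EE u)\<^sup>2"
          unfolding p_q by auto
        show "a \<in> T_max p q e (R_F p e b) \<union> T_min p q e (R_F p e b)"
          using S_cases[OF u(1)] in_K[OF u(1)] T_max[of a] T_min[of a] unfolding u(2) p_q by auto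
      qed
      show "T_max p q e (R_F p e b)
          = {alpha_F p e b t0 + (E_F p e b u)\<^sup>2 | u.
               u \<in> GF q \<and> Tr2 N (u * R_Ft p e b t0 u) = of_nat (n + 1)}"
      proof (intro set_eqI iffI)
        fix a assume "a \<in> T_max p q e (R_F p e b)"
        then have a: "a \<in> K" "S a = r"
          using T_max[of a] unfolding p_q by auto
        then obtain u where u: "u \<in> K" "a = \<alpha> t0 + (EE u)\<^sup>2"
          using sgn by auto
        with a have "Tr2 N (q_form t0 u) = of_nat (n + 1)"
          by (simp only: S_iff)
        with u show "a \<in> {alpha_F p e b t0 + (E_F p e b u)\<^sup>2 | u.
            u \<in> GF q \<and> Tr2 N (u * R_Ft p e b t0 u) = of_nat (n + 1)}"
          unfolding p_q mem_Collect_eq by (intro exI[of _ u] conjI)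
      next
        fix a assume "a \<in> {alpha_F p e b t0 + (E_F p e b u)\<^sup>2 | u.
            u \<in> GF q \<and> Tr2 N (u * R_Ft p e b t0 u) = of_nat (n + 1)}"
        then obtain u where u: "u \<in> K" "a = \<alpha> t0 + (EE u)\<^sup>2" "Tr2 N (q_form t0 u) = of_nat (n + 1)"
          unfolding p_q mem_Collect_eq by (elim exE conjE)
        then have "S a = r" by (simp only: S_iff)
        with u(1) show "a \<in> T_max p q e (R_F p e b)"
          using T_max[of a] in_K[of u] unfolding u(2) p_q by simp
      qed
    qed
  qed
  show ?thesis using ex main by blast
qed

end
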